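(* The desingularization transforms a $b^m$-integrable system into an integrable system on a symplectic manifold for $m$ even. For $m$ odd the desingularization transforms it into a folded integrable system. The integrable systems are such that $$X^{\omega}_{f_j}=X^{\omega_\epsilon}_{f_{j\epsilon}},$$ where $\omega$ is the $b^m$-symplectic form, $(f_1,\dots,f_n)$ the $b^m$-integrable system, $\omega_\epsilon$ and $(f_{1\epsilon},\dots,f_{n\epsilon})$ their desingularizations, and $X_f^{\omega}$ denotes the Hamiltonian vector field of $f$ with respect to $\omega$.
   Context: A $b^m$-symplectic form on $(M^{2n},Z)$, $Z$ a hypersurface with defining function $x$, is a closed non-degenerate 2-form on the bundle ${}^{b^m}TM$ whose sections are generated near $Z$ by $x^m\partial_x,\partial_{x_1},\dots,\partial_{x_{2n-1}}$. Near $Z$ it can be written $\omega=\frac{dx}{x^m}\wedge\left(\sum_{i=0}^{m-1}x^i\alpha_{m-i}\right)+\beta$, with $\alpha_j$ pulled back from closed one-forms on $Z$ and $\beta$ a smooth 2-form. The $b^m$-functions are defined recursively by ${}^{b^m}C^\infty(M)=x^{-(m-1)}C^\infty(x)+{}^{b^{m-1}}C^\infty(M)$, where $C^\infty(x)$ are the smooth functions of $x$ and ${}^bC^\infty(M)=\{g\log|x|+h:\ g\in\mathbb R,\ h\in C^\infty(M)\}$. A $b^m$-integrable system is an $n$-tuple of pairwise Poisson-commuting $b^m$-functions whose differentials are independent (as $b^m$-forms) on a dense subset of $M$ and at all points of $Z$. Desingularization of the form: $\omega_\epsilon=df_\epsilon\wedge\left(\sum_{i=0}^{m-1}x^i\alpha_{m-i}\right)+\beta$,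 where: - for $m=2k$: $f_\epsilon(x)=\epsilon^{-(2k-1)}f(x/\epsilon)$, with $f\in C^\infty(\mathbb R)$ odd, $f'(x)>0$ for $x\in[-1,1]$, $f(x)=\frac{-1}{(2k-1)x^{2k-1}}-2$ for $x<-1$ and $f(x)=\frac{-1}{(2k-1)x^{2k-1}}+2$ for $x>1$; - for $m=2k+1$: $f_\epsilon(x)=\epsilon^{-2k}f(x/\epsilon)$, with $f\in C^\infty(\mathbb R)$ an even smooth positive function satisfying $f'(x)<0$ if $x<0$, $f(x)=-x^2+2$ for $x\in[-1,1]$, and, for $x\in\mathbb R\setminus[-2,2]$, $f(x)=\frac{-1}{(2k+2)x^{2k+2}}-2$ if $k>0$ and $f(x)=\log|x|$ if $k=0$. Desingularization of the system: put $F^i_\epsilon(x)=\left(\frac{d}{dx}f_\epsilon(x)\right)x^{m-i}$ and $G_\epsilon^i(x)=\int_0^xF_\epsilon^i(\tau)\,d\tau$. The desingularization of $(M,\omega,\mu)$, with $\mu=\bigl(f_1=c_0\log(x)+\sum_{i=1}^{m-1}c_i\frac1{x^i},\,f_2(I,\phi),\dots,f_n(I,\phi)\bigr)$, is $(M,\omega_\epsilon,\mu_\epsilon)$ with $$\mu_\epsilon=\Bigl(f_{1\epsilon}=\sum_{i=1}^m\hat c_iG_\epsilon^i(x),\ f_{2\epsilon}=f_2(\tilde I,\tilde\phi),\dots,f_{n\epsilon}=f_n(\tilde I,\tilde\phi)\Bigr),$$ where $\hat c_1=c_0$, $\hat c_i=-(i-1)c_{i-1}$ for $i\ge2$, $\tilde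 I=(\tilde I_1,I_2,\dots,I_n)$, $\tilde\phi=(\tilde\phi_1,\phi_2,\dots,\phi_n)$, $$\tilde I_1=\int_0^{I_1}\frac{\sum_{i=1}^m\mathcal K\hat c_iF^i_\epsilon(\tau)}{\sum_{j=1}^m\mathcal K\hat c_j/\tau^j}\,d\tau,\qquad\tilde\phi_1=\frac{\sum_{i=1}^m\mathcal K\hat c_iF^i_\epsilon(I_1)}{\sum_{j=1}^m\mathcal K\hat c_j/I_1^j}\,\phi_1.$$ Here $(I,\phi)=(I_1,\dots,I_n,\phi_1,\dots,\phi_n)$ denote the action-angle coordinates of the system ($x=I_1$), in which $\omega=\sum_{i=1}^m\frac{\mathcal K\hat c_i}{I_1^i}dI_1\wedge d\phi_1+\sum_{i=2}^ndI_i\wedge d\phi_i$, with $\mathcal K$ the modular period and the $c_i$ constants. A folded symplectic form is a closed 2-form whose top power is transverse to zero along a hypersurface $Z$ and whose restriction to $Z$ has maximal rank. On a folded symplectic manifold a function $f$ is folded if $df|_Z(v)=0$ for all $v\in V=\ker\omega|_Z$; the folded cotangent bundle is the bundle whose sections are the one-forms vanishing on $V$ along $Z$. A folded integrable system is a set of $n$ functions defining Hamiltonian vector fields which are independent ($df_1\wedge\dots\wedge df_n\ne0$ in the folded cotangent bundle) on a dense subset of $Z$ and $M$, and commuting with respect to $\omega$.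
   Formalization: Stated in an action-angle chart with convex action domain, where μ_ε is defined; f_j smooth for j≥2. Field equality for j≥2 fails for f_2=I_2+I_1I_2; proved exactly where df_j agrees at (I,φ) and (Ĩ,φ̃). The contradictory odd-m conditions on f are relaxed (any quadratic, no positivity). *)

theory Defs
  imports "HOL-Analysis.Analysis"
begin

section \<open>Calculus on \<open>A \<times> T\<^sup>n\<close>\<close>

text \<open>
  Action-angle coordinates \<open>(I, \<phi>)\<close>. Objects on \<open>A \<times> T\<^sup>n\<close> (\<open>A\<close> an open set of actions) are
  represented by their lifts to \<open>A \<times> UNIV\<close>, i.e. by objects that are \<open>2\<pi>\<close>-periodic in every angle.
  Tangent vectors have the same type as points. The index set \<open>{1,\<dots>,n}\<close> is the type \<open>'n\<close>, in
  which a parameter \<open>r :: 'n\<close> plays the role of the index \<open>1\<close>; the defining function of the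
  hypersurface is \<open>x = I\<^sub>1\<close>.
\<close>

type_synonym 'n phase = "(real ^ 'n) \<times> (real ^ 'n)"
type_synonym 'n two_form = "'n phase \<Rightarrow> 'n phase \<Rightarrow> 'n phase \<Rightarrow> real"

definition act :: "'n::finite \<Rightarrow> 'n phase \<Rightarrow> real" where
  "act a p = fst p $ a"

definition ang :: "'n::finite \<Rightarrow> 'n phase \<Rightarrow> real" where
  "ang a p = snd p $ a"

definition hypersurface :: "'n::finite \<Rightarrow> 'n phase set" where
  "hypersurface r = {p. act r p = 0}"

definition phase_domain :: "'n::finite phase set \<Rightarrow> bool" where
  "phase_domain S \<longleftrightarrow> (\<exists>A. open A \<and> A \<noteq> {} \<and> S = A \<times> UNIV)"

definition angle_periodic_on :: "'n::finite phase set \<Rightarrow> ('n phase \<Rightarrow> 'b) \<Rightarrow> bool" where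
  "angle_periodic_on S h \<longleftrightarrow> (\<forall>p\<in>S. \<forall>a. h (p + (0, axis a (2 * pi))) = h p)"

primrec Ck_on :: "nat \<Rightarrow> 'a::euclidean_space set \<Rightarrow> ('a \<Rightarrow> 'b::real_normed_vector) \<Rightarrow> bool" where
  "Ck_on 0 S h \<longleftrightarrow> continuous_on S h"
| "Ck_on (Suc k) S h \<longleftrightarrow>
     (\<forall>x\<in>S. h differentiable (at x)) \<and> (\<forall>v. Ck_on k S (\<lambda>x. frechet_derivative h (at x) v))"

text \<open>Only meant for open \<open>S\<close>.\<close>

definition smooth_on :: "'a::euclidean_space set \<Rightarrow> ('a \<Rightarrow> 'b::real_normed_vector) \<Rightarrow> bool" where
  "smooth_on S h \<longleftrightarrow> (\<forall>k. Ck_on k S h)"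

definition differential :: "('n::finite phase \<Rightarrow> real) \<Rightarrow> 'n phase \<Rightarrow> 'n phase \<Rightarrow> real" where
  "differential h p = frechet_derivative h (at p)"

definition independent_covectors :: "('n::finite \<Rightarrow> 'n phase \<Rightarrow> real) \<Rightarrow> bool" where
  "independent_covectors \<delta> \<longleftrightarrow>
     (\<forall>a. (\<forall>v. (\<Sum>j\<in>UNIV. a j * \<delta> j v) = 0) \<longrightarrow> (\<forall>j. a j = 0))"

definition two_form_on :: "'n::finite phase set \<Rightarrow> 'n two_form \<Rightarrow> bool" where
  "two_form_on S \<omega> \<longleftrightarrow>
     (\<forall>p\<in>S. \<forall>u. linear (\<omega> p u) \<and> linear (\<lambda>w. \<omega> p w u) \<and> \<omega> p u u = 0) \<and>
     (\<forall>u v. smooth_on S (\<lambda>p. \<omega> p u v)) \<and> angle_periodic_on S \<omega>"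

definition nondegenerate_on :: "'n::finite phase set \<Rightarrow> 'n two_form \<Rightarrow> bool" where
  "nondegenerate_on S \<omega> \<longleftrightarrow> (\<forall>p\<in>S. \<forall>u. (\<forall>v. \<omega> p u v = 0) \<longrightarrow> u = 0)"

text \<open>\<open>d\<omega>(u,v,w)\<close> for constant vector fields \<open>u, v, w\<close>, whose Lie brackets vanish.\<close>

definition closed_form_on :: "'n::finite phase set \<Rightarrow> 'n two_form \<Rightarrow> bool" where
  "closed_form_on S \<omega> \<longleftrightarrow>
     (\<forall>p\<in>S. \<forall>u v w. differential (\<lambda>q. \<omega> q v w) p u - differential (\<lambda>q. \<omega> q u w) p v
        + differential (\<lambda>q. \<omega> q u v) p w = 0)"

definition symplectic_on :: "'n::finite phase set \<Rightarrow> 'n two_form \<Rightarrow> bool" where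
  "symplectic_on S \<omega> \<longleftrightarrow> two_form_on S \<omega> \<and> closed_form_on S \<omega> \<and> nondegenerate_on S \<omega>"

definition vector_field_on :: "'n::finite phase set \<Rightarrow> ('n phase \<Rightarrow> 'n phase) \<Rightarrow> bool" where
  "vector_field_on S X \<longleftrightarrow> smooth_on S X \<and> angle_periodic_on S X"

definition hamiltonian_vf ::
  "'n::finite phase set \<Rightarrow> 'n two_form \<Rightarrow> ('n phase \<Rightarrow> real) \<Rightarrow> ('n phase \<Rightarrow> 'n phase) \<Rightarrow> bool" where
  "hamiltonian_vf S \<omega> h X \<longleftrightarrow>
     vector_field_on S X \<and> (\<forall>p\<in>S. \<forall>v. \<omega> p (X p) v = - differential h p v)"

definition commuting_on ::
  "'n::finite phase set \<Rightarrow> 'n two_form \<Rightarrow> ('n \<Rightarrow> 'n phase \<Rightarrow> real) \<Rightarrow> bool" where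
  "commuting_on S \<omega> f \<longleftrightarrow>
     (\<exists>X. (\<forall>j. hamiltonian_vf S \<omega> (f j) (X j)) \<and> (\<forall>i j. \<forall>p\<in>S. \<omega> p (X i p) (X j p) = 0))"

definition integrable_system ::
  "'n::finite phase set \<Rightarrow> 'n two_form \<Rightarrow> ('n \<Rightarrow> 'n phase \<Rightarrow> real) \<Rightarrow> bool" where
  "integrable_system S \<omega> f \<longleftrightarrow>
     phase_domain S \<and> symplectic_on S \<omega> \<and>
     (\<forall>j. smooth_on S (f j) \<and> angle_periodic_on S (f j)) \<and> commuting_on S \<omega> f \<and>
     (\<exists>D\<subseteq>S. S \<subseteq> closure D \<and> (\<forall>p\<in>D. independent_covectors (\<lambda>j. differential (f j) p)))"

section \<open>\<open>b\<^sup>m\<close>-geometry\<close>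

text \<open>
  The \<open>b\<^sup>m\<close>-tangent bundle is trivialised by \<open>x\<^sup>m\<partial>\<^sub>x\<close> and the remaining coordinate fields. A vector
  of coefficients in that frame is sent by \<open>anchor\<close> to the tangent vector it represents.
\<close>

definition anchor :: "'n::finite \<Rightarrow> nat \<Rightarrow> 'n phase \<Rightarrow> 'n phase \<Rightarrow> 'n phase" where
  "anchor r m p v = ((\<chi> a. if a = r then act r p ^ m * act r v else act a v), snd v)"

text \<open>
  A \<open>b\<^sup>m\<close>-form is given by its values off the hypersurface, together with the requirement that its
  coefficients in the \<open>b\<^sup>m\<close>-frame (\<open>\<omega>b\<close> below) extend smoothly; closedness extends by density.
\<close>

definition bm_symplectic_on :: "'n::finite \<Rightarrow> nat \<Rightarrow> 'n phase set \<Rightarrow> 'n two_form \<Rightarrow> bool" where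
  "bm_symplectic_on r m S \<omega> \<longleftrightarrow>
     closed_form_on (S - hypersurface r) \<omega> \<and>
     (\<exists>\<omega>b. two_form_on S \<omega>b \<and> nondegenerate_on S \<omega>b \<and>
        (\<forall>p\<in>S - hypersurface r. \<forall>u v. \<omega> p (anchor r m p u) (anchor r m p v) = \<omega>b p u v))"

text \<open>The case \<open>m = 0\<close> is not part of the recursion of the \<open>b\<^sup>m\<close>-functions and only completes it.\<close>

fun bm_function :: "'n::finite \<Rightarrow> nat \<Rightarrow> 'n phase set \<Rightarrow> ('n phase \<Rightarrow> real) \<Rightarrow> bool" where
  "bm_function r 0 S h \<longleftrightarrow> smooth_on S h \<and> angle_periodic_on S h"
| "bm_function r (Suc 0) S h \<longleftrightarrow>
     (\<exists>g s. smooth_on S s \<and> angle_periodic_on S s \<and>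
        (\<forall>p\<in>S - hypersurface r. h p = g * ln \<bar>act r p\<bar> + s p))"
| "bm_function r (Suc (Suc m)) S h \<longleftrightarrow>
     (\<exists>u s. smooth_on (act r ` S) u \<and> bm_function r (Suc m) S s \<and>
        (\<forall>p\<in>S - hypersurface r. h p = u (act r p) / act r p ^ Suc m + s p))"

definition bm_differential ::
  "'n::finite \<Rightarrow> nat \<Rightarrow> 'n phase set \<Rightarrow> ('n phase \<Rightarrow> real) \<Rightarrow> ('n phase \<Rightarrow> 'n phase \<Rightarrow> real) \<Rightarrow> bool" where
  "bm_differential r m S h \<delta> \<longleftrightarrow>
     (\<forall>v. smooth_on S (\<lambda>p. \<delta> p v)) \<and> (\<forall>p\<in>S. linear (\<delta> p)) \<and>
     (\<forall>p\<in>S - hypersurface r. \<forall>v. \<delta> p v = differential h p (anchor r m p v))"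

definition bm_hamiltonian_vf ::
  "'n::finite \<Rightarrow> nat \<Rightarrow> 'n phase set \<Rightarrow> 'n two_form \<Rightarrow> ('n phase \<Rightarrow> real)
     \<Rightarrow> ('n phase \<Rightarrow> 'n phase) \<Rightarrow> bool" where
  "bm_hamiltonian_vf r m S \<omega> h X \<longleftrightarrow>
     (\<exists>Y. vector_field_on S Y \<and> (\<forall>p\<in>S. X p = anchor r m p (Y p))) \<and>
     (\<forall>p\<in>S - hypersurface r. \<forall>v. \<omega> p (X p) v = - differential h p v)"

definition bm_commuting_on ::
  "'n::finite \<Rightarrow> nat \<Rightarrow> 'n phase set \<Rightarrow> 'n two_form \<Rightarrow> ('n \<Rightarrow> 'n phase \<Rightarrow> real) \<Rightarrow> bool" where
  "bm_commuting_on r m S \<omega> f \<longleftrightarrow>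
     (\<exists>X. (\<forall>j. bm_hamiltonian_vf r m S \<omega> (f j) (X j)) \<and>
        (\<forall>i j. \<forall>p\<in>S - hypersurface r. \<omega> p (X i p) (X j p) = 0))"

definition bm_integrable_system ::
  "'n::finite \<Rightarrow> nat \<Rightarrow> 'n phase set \<Rightarrow> 'n two_form \<Rightarrow> ('n \<Rightarrow> 'n phase \<Rightarrow> real) \<Rightarrow> bool" where
  "bm_integrable_system r m S \<omega> f \<longleftrightarrow>
     phase_domain S \<and> bm_symplectic_on r m S \<omega> \<and>
     (\<forall>j. bm_function r m S (f j)) \<and> bm_commuting_on r m S \<omega> f \<and>
     (\<exists>\<delta> D. (\<forall>j. bm_differential r m S (f j) (\<delta> j)) \<and> D \<subseteq> S \<and> S \<subseteq> closure D \<and>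
        (\<forall>p \<in> D \<union> (S \<inter> hypersurface r). independent_covectors (\<lambda>j. \<delta> j p)))"

section \<open>Folded symplectic geometry\<close>

definition frame :: "'n::finite + 'n \<Rightarrow> 'n phase" where
  "frame = case_sum (\<lambda>a. (axis a 1, 0)) (\<lambda>a. (0, axis a 1))"

text \<open>\<open>\<omega>\<^sup>n\<close> evaluated on \<open>(\<partial>\<^bsub>I\<^sub>1\<^esub>, \<partial>\<^bsub>\<phi>\<^sub>1\<^esub>, \<dots>, \<partial>\<^bsub>I\<^sub>n\<^esub>, \<partial>\<^bsub>\<phi>\<^sub>n\<^esub>)\<close>.\<close>

definition top_power :: "'n::finite two_form \<Rightarrow> 'n phase \<Rightarrow> real" where
  "top_power \<omega> p =
     (\<Sum>\<sigma> | \<sigma> permutes (UNIV :: ('n + 'n) set).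
        of_int (sign \<sigma>) * (\<Prod>a\<in>UNIV. \<omega> p (frame (\<sigma> (Inl a))) (frame (\<sigma> (Inr a))))) / 2 ^ CARD('n)"

text \<open>
  The restriction of \<open>\<omega>\<close> to the odd-dimensional \<open>T\<^sub>pZ = {v. dx(v) = 0}\<close> has maximal rank iff its
  kernel is a line.
\<close>

definition folded_symplectic_on :: "'n::finite \<Rightarrow> 'n phase set \<Rightarrow> 'n two_form \<Rightarrow> bool" where
  "folded_symplectic_on r S \<omega> \<longleftrightarrow>
     two_form_on S \<omega> \<and> closed_form_on S \<omega> \<and>
     {p\<in>S. top_power \<omega> p = 0} = S \<inter> hypersurface r \<and>
     (\<forall>p\<in>S \<inter> hypersurface r. differential (top_power \<omega>) p \<noteq> (\<lambda>_. 0)) \<and>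
     (\<forall>p\<in>S \<inter> hypersurface r.
        dim {u. act r u = 0 \<and> (\<forall>v. act r v = 0 \<longrightarrow> \<omega> p u v = 0)} = 1)"

text \<open>The fibre of \<open>V = ker \<omega>|\<^sub>Z\<close>, the kernel of \<open>\<omega>\<^sub>p\<close> on the whole tangent space at \<open>p \<in> Z\<close>.\<close>

definition fold_kernel :: "'n::finite two_form \<Rightarrow> 'n phase \<Rightarrow> 'n phase set" where
  "fold_kernel \<omega> p = {v. \<forall>u. \<omega> p v u = 0}"

definition folded_function_on ::
  "'n::finite \<Rightarrow> 'n phase set \<Rightarrow> 'n two_form \<Rightarrow> ('n phase \<Rightarrow> real) \<Rightarrow> bool" where
  "folded_function_on r S \<omega> h \<longleftrightarrow>
     smooth_on S h \<and> angle_periodic_on S h \<and>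
     (\<forall>p\<in>S \<inter> hypersurface r. \<forall>v\<in>fold_kernel \<omega> p. differential h p v = 0)"

definition folded_one_form_on ::
  "'n::finite \<Rightarrow> 'n phase set \<Rightarrow> 'n two_form \<Rightarrow> ('n phase \<Rightarrow> 'n phase \<Rightarrow> real) \<Rightarrow> bool" where
  "folded_one_form_on r S \<omega> \<alpha> \<longleftrightarrow>
     (\<forall>v. smooth_on S (\<lambda>p. \<alpha> p v)) \<and> (\<forall>p\<in>S. linear (\<alpha> p)) \<and>
     (\<forall>p\<in>S \<inter> hypersurface r. \<forall>v\<in>fold_kernel \<omega> p. \<alpha> p v = 0)"

text \<open>
  The folded cotangent bundle is the bundle whose local sections are the folded one-forms. Hence a
  section vanishes at \<open>p\<close> iff near \<open>p\<close> it is a finite combination of sections whose coefficient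
  functions vanish at \<open>p\<close>. (On the hypersurface this is stronger than vanishing of the covector:
  \<open>x dx\<close> is nonzero there as a section of the folded cotangent bundle.)
\<close>

definition folded_vanishes_at ::
  "'n::finite \<Rightarrow> 'n phase set \<Rightarrow> 'n two_form \<Rightarrow> ('n phase \<Rightarrow> 'n phase \<Rightarrow> real) \<Rightarrow> 'n phase \<Rightarrow> bool" where
  "folded_vanishes_at r S \<omega> \<theta> p \<longleftrightarrow>
     (\<exists>W N g \<alpha>. open W \<and> p \<in> W \<and> W \<subseteq> S \<and>
        (\<forall>k<N. smooth_on W (g k) \<and> g k p = 0 \<and> folded_one_form_on r W \<omega> (\<alpha> k)) \<and>
        (\<forall>q\<in>W. \<forall>v. \<theta> q v = (\<Sum>k<(N::nat). g k q * \<alpha> k q v)))"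

definition folded_independent_at ::
  "'n::finite \<Rightarrow> 'n phase set \<Rightarrow> 'n two_form \<Rightarrow> ('n \<Rightarrow> 'n phase \<Rightarrow> real) \<Rightarrow> 'n phase \<Rightarrow> bool" where
  "folded_independent_at r S \<omega> f p \<longleftrightarrow>
     (\<forall>a. folded_vanishes_at r S \<omega> (\<lambda>q v. \<Sum>j\<in>UNIV. a j * differential (f j) q v) p
        \<longrightarrow> (\<forall>j. a j = 0))"

definition folded_integrable_system ::
  "'n::finite \<Rightarrow> 'n phase set \<Rightarrow> 'n two_form \<Rightarrow> ('n \<Rightarrow> 'n phase \<Rightarrow> real) \<Rightarrow> bool" where
  "folded_integrable_system r S \<omega> f \<longleftrightarrow>
     phase_domain S \<and> folded_symplectic_on r S \<omega> \<and>
     (\<forall>j. folded_function_on r S \<omega> (f j)) \<and> commuting_on S \<omega> f \<and>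
     (\<exists>D\<subseteq>S. S \<subseteq> closure D \<and> S \<inter> hypersurface r \<subseteq> closure (D \<inter> hypersurface r) \<and>
        (\<forall>p\<in>D. folded_independent_at r S \<omega> f p))"

section \<open>Desingularization\<close>

definition hat_c :: "(nat \<Rightarrow> real) \<Rightarrow> nat \<Rightarrow> real" where
  "hat_c c i = (if i = 1 then c 0 else - real (i - 1) * c (i - 1))"

definition wedge :: "('n phase \<Rightarrow> real) \<Rightarrow> ('n phase \<Rightarrow> real) \<Rightarrow> 'n phase \<Rightarrow> 'n phase \<Rightarrow> real" where
  "wedge \<alpha> \<beta> u v = \<alpha> u * \<beta> v - \<alpha> v * \<beta> u"

text \<open>The coordinate one-forms \<open>dI\<^sub>a\<close>, \<open>d\<phi>\<^sub>a\<close> are constant, hence equal to \<open>act a\<close>, \<open>ang a\<close> on vectors.\<close>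

definition action_angle_form ::
  "'n::finite \<Rightarrow> nat \<Rightarrow> real \<Rightarrow> (nat \<Rightarrow> real) \<Rightarrow> 'n two_form" where
  "action_angle_form r m K c p u v =
     (\<Sum>i=1..m. K * hat_c c i / act r p ^ i) * wedge (act r) (ang r) u v
     + (\<Sum>a\<in>UNIV - {r}. wedge (act a) (ang a) u v)"

text \<open>
  \<open>\<rho>(x) dx \<and> (\<Sum>\<^bsub>i<m\<^esub> x\<^sup>i \<alpha>\<^bsub>m-i\<^esub>) + \<beta>\<close>. The form \<open>\<omega>\<close> has \<open>\<rho>(x) = 1/x\<^sup>m\<close>, its desingularization has
  \<open>\<rho> = f\<^sub>\<epsilon>'\<close>.
\<close>

definition laurent_form ::
  "'n::finite \<Rightarrow> nat \<Rightarrow> (real \<Rightarrow> real) \<Rightarrow> (nat \<Rightarrow> 'n phase \<Rightarrow> real) \<Rightarrow> ('n phase \<Rightarrow> 'n phase \<Rightarrow> real)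
     \<Rightarrow> 'n two_form" where
  "laurent_form r m \<rho> \<alpha> \<beta> p u v =
     wedge (\<lambda>w. \<rho> (act r p) * act r w) (\<lambda>w. \<Sum>i<m. act r p ^ i * \<alpha> (m - i) w) u v + \<beta> u v"

definition laurent_alpha :: "'n::finite \<Rightarrow> real \<Rightarrow> (nat \<Rightarrow> real) \<Rightarrow> nat \<Rightarrow> 'n phase \<Rightarrow> real" where
  "laurent_alpha r K c i w = K * hat_c c i * ang r w"

definition laurent_beta :: "'n::finite \<Rightarrow> 'n phase \<Rightarrow> 'n phase \<Rightarrow> real" where
  "laurent_beta r u v = (\<Sum>a\<in>UNIV - {r}. wedge (act a) (ang a) u v)"

lemma action_angle_form_eq_laurent_form:
  assumes "act r p \<noteq> 0"
  shows "action_angle_form r m K c p u v =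
    laurent_form r m (\<lambda>x. 1 / x ^ m) (laurent_alpha r K c) (laurent_beta r) p u v"
proof -
  let ?x = "act r p"
  have "(\<Sum>i=1..m. K * hat_c c i / ?x ^ i) = (\<Sum>i<m. K * hat_c c (m - i) / ?x ^ (m - i))"
    by (rule sum.reindex_bij_witness[where i = "\<lambda>i. m - i" and j = "\<lambda>i. m - i"]) auto
  also have "\<dots> = (\<Sum>i<m. 1 / ?x ^ m * (?x ^ i * (K * hat_c c (m - i))))"
    using assms by (intro sum.cong) (auto simp: power_diff field_simps)
  finally have "(\<Sum>i=1..m. K * hat_c c i / ?x ^ i) =
      1 / ?x ^ m * (\<Sum>i<m. ?x ^ i * (K * hat_c c (m - i)))"
    by (simp add: sum_distrib_left)
  moreover have "(\<Sum>i<m. ?x ^ i * (K * hat_c c (m - i) * ang r w)) =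
      (\<Sum>i<m. ?x ^ i * (K * hat_c c (m - i))) * ang r w" for w
    by (simp add: sum_distrib_right mult.assoc)
  ultimately show ?thesis
    by (simp add: action_angle_form_def laurent_form_def laurent_alpha_def laurent_beta_def
        wedge_def algebra_simps diff_divide_distrib)
qed

definition even_profile :: "nat \<Rightarrow> (real \<Rightarrow> real) \<Rightarrow> bool" where
  "even_profile k F \<longleftrightarrow>
     smooth_on UNIV F \<and> (\<forall>x. F (- x) = - F x) \<and> (\<forall>x\<in>{-1..1}. deriv F x > 0) \<and>
     (\<forall>x< -1. F x = - 1 / (real (2 * k - 1) * x ^ (2 * k - 1)) - 2) \<and>
     (\<forall>x>1. F x = - 1 / (real (2 * k - 1) * x ^ (2 * k - 1)) + 2)"

text \<open>
  The requirements \<open>F > 0\<close>, \<open>F' < 0\<close> on the negative axis, \<open>F(x) = -x\<^sup>2 + 2\<close> on \<open>[-1,1]\<close> and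
  \<open>F(x) = -1/((2k+2)x\<^bsup>2k+2\<^esup>) - 2\<close> (resp. \<open>log |x|\<close>) off \<open>[-2,2]\<close> found in the literature contradict
  each other. The conditions below are implied by them and are satisfiable: positivity is not
  required, the quadratic polynomial is not prescribed, and the exponent \<open>2k\<close>, for which \<open>F'(x) = x\<^bsup>-(2k+1)\<^esup>\<close>
  off \<open>[-2,2]\<close>, is admitted besides \<open>2k+2\<close>.
\<close>

definition odd_profile :: "nat \<Rightarrow> (real \<Rightarrow> real) \<Rightarrow> bool" where
  "odd_profile k F \<longleftrightarrow>
     smooth_on UNIV F \<and> (\<forall>x. F (- x) = F x) \<and> (\<forall>x<0. deriv F x < 0) \<and>
     (\<exists>a b. \<forall>x\<in>{-1..1}. F x = a * x ^ 2 + b) \<and>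
     (if k = 0 then \<forall>x. \<bar>x\<bar> > 2 \<longrightarrow> F x = ln \<bar>x\<bar>
      else \<exists>d\<in>{2 * k, 2 * k + 2}. \<forall>x. \<bar>x\<bar> > 2 \<longrightarrow> F x = - 1 / (real d * x ^ d) - 2)"

definition desing_profile :: "nat \<Rightarrow> (real \<Rightarrow> real) \<Rightarrow> bool" where
  "desing_profile m F \<longleftrightarrow>
     (\<exists>k\<ge>1. m = 2 * k \<and> even_profile k F) \<or> (\<exists>k. m = 2 * k + 1 \<and> odd_profile k F)"

definition f_eps :: "nat \<Rightarrow> (real \<Rightarrow> real) \<Rightarrow> real \<Rightarrow> real \<Rightarrow> real" where
  "f_eps m F \<epsilon> x = F (x / \<epsilon>) / \<epsilon> ^ (m - 1)"

definition desing_form ::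
  "'n::finite \<Rightarrow> nat \<Rightarrow> real \<Rightarrow> (nat \<Rightarrow> real) \<Rightarrow> (real \<Rightarrow> real) \<Rightarrow> real \<Rightarrow> 'n two_form" where
  "desing_form r m K c F \<epsilon> =
     laurent_form r m (deriv (f_eps m F \<epsilon>)) (laurent_alpha r K c) (laurent_beta r)"

definition F_eps :: "nat \<Rightarrow> (real \<Rightarrow> real) \<Rightarrow> real \<Rightarrow> nat \<Rightarrow> real \<Rightarrow> real" where
  "F_eps m F \<epsilon> i x = deriv (f_eps m F \<epsilon>) x * x ^ (m - i)"

definition G_eps :: "nat \<Rightarrow> (real \<Rightarrow> real) \<Rightarrow> real \<Rightarrow> nat \<Rightarrow> real \<Rightarrow> real" where
  "G_eps m F \<epsilon> i x = (LBINT \<tau>=0..x. F_eps m F \<epsilon> i \<tau>)"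

text \<open>
  At \<open>x = 0\<close> the convention \<open>y / 0 = 0\<close> yields \<open>0\<close>, which is the limit there: for \<open>x \<noteq> 0\<close> the
  quotient equals \<open>f\<^sub>\<epsilon>'(x) x\<^sup>m\<close> whenever the denominator is nonzero.
\<close>

definition desing_ratio ::
  "nat \<Rightarrow> real \<Rightarrow> (nat \<Rightarrow> real) \<Rightarrow> (real \<Rightarrow> real) \<Rightarrow> real \<Rightarrow> real \<Rightarrow> real" where
  "desing_ratio m K c F \<epsilon> x =
     (\<Sum>i=1..m. K * hat_c c i * F_eps m F \<epsilon> i x) / (\<Sum>j=1..m. K * hat_c c j / x ^ j)"

definition desing_coord ::
  "'n::finite \<Rightarrow> nat \<Rightarrow> real \<Rightarrow> (nat \<Rightarrow> real) \<Rightarrow> (real \<Rightarrow> real) \<Rightarrow> real \<Rightarrow> 'n phase \<Rightarrow> 'n phase" where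
  "desing_coord r m K c F \<epsilon> p =
     ((\<chi> a. if a = r then (LBINT \<tau>=0..act r p. desing_ratio m K c F \<epsilon> \<tau>) else act a p),
      (\<chi> a. if a = r then desing_ratio m K c F \<epsilon> (act r p) * ang r p else ang a p))"

definition desing_map ::
  "'n::finite \<Rightarrow> nat \<Rightarrow> real \<Rightarrow> (nat \<Rightarrow> real) \<Rightarrow> (real \<Rightarrow> real) \<Rightarrow> real
     \<Rightarrow> ('n \<Rightarrow> 'n phase \<Rightarrow> real) \<Rightarrow> 'n \<Rightarrow> 'n phase \<Rightarrow> real" where
  "desing_map r m K c F \<epsilon> f j p =
     (if j = r then \<Sum>i=1..m. hat_c c i * G_eps m F \<epsilon> i (act r p)
      else f j (desing_coord r m K c F \<epsilon> p))"

text \<open>The part of \<open>M\<close> on which the functions \<open>f\<^sub>j\<close> can be evaluated at the new coordinates.\<close>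

definition desing_domain ::
  "'n::finite \<Rightarrow> nat \<Rightarrow> real \<Rightarrow> (nat \<Rightarrow> real) \<Rightarrow> (real \<Rightarrow> real) \<Rightarrow> real \<Rightarrow> 'n phase set \<Rightarrow> 'n phase set" where
  "desing_domain r m K c F \<epsilon> M = {p\<in>M. desing_coord r m K c F \<epsilon> p \<in> M}"

end

(*
  Since X_{f_r} is the constant multiple 1/K of the field along phi_r, commutation forces every f_j
  with j ~= r to be independent of phi_r. The scaling of phi_r in the new coordinates is therefore
  invisible to f_j, and only the substitution x -> h(x) with h'(x) = f_eps'(x) x^m > 0 off x = 0
  remains. It multiplies the dI_r-component of df_j by f_eps'(x) x^m, while the coefficient P(x) / x^m
  of omega (P polynomial without zeros on the domain) becomes f_eps'(x) P(x); so the factor f_eps'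
  cancels in the Hamiltonian vector field, which stays smooth even where f_eps' vanishes (the fold).
  Independence on a dense set is transported by the map x -> h(x), which is open by invariance of
  domain.
*)

theory Submission
  imports Defs
begin

section \<open>Smooth functions\<close>

text \<open>The three two-forms involved (\<open>\<omega>\<close>, its matrix in the b^m-frame, and
  the desingularized form) differ only in the coefficient of the pair I_r, \<phi>_r. All Hamiltonian
  vectors therefore have one closed form.

  Passing to h moves the point at which df_j is evaluated. For j \<noteq> r, the two Hamiltonian
  vector fields agree at p exactly if df_j is the same at p and at the new coordinates of p. This
  holds for f_j = I_j. It fails at points close to Z but off it for f_j = (1 + I_r) I_j: since h(0)
  = h'(0) = 0, h(x) \<noteq> x for small x \<noteq> 0. Hence the theorem characterizes equality
  pointwise and adds the value of \<open>\<omega>\<close> on the desingularized field.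

  Two obstacles shape the rest. The b^m-objects are tied to \<open>\<omega>\<close> and
  \<open>f\<close> by equations off Z only, so each formula is proved there and carried to Z by
  continuity. For m odd, f_eps'(0) = 0 makes the covector of the first desingularized function
  vanish on Z; independence is then a statement about sections, decided by f_eps' having a simple
  zero at 0.\<close>

lemma frechet_derivative_works':
  "h differentiable (at x) \<Longrightarrow> (h has_derivative frechet_derivative h (at x)) (at x)"
  using frechet_derivative_works by blast

lemma Ck_on_imp_continuous_on: "Ck_on k S h \<Longrightarrow> continuous_on S h"
  by (cases k) (auto intro!: differentiable_imp_continuous_on differentiable_at_imp_differentiable_on)

lemma Ck_on_cong:
  assumes "open S" and "\<And>x. x \<in> S \<Longrightarrow> h x = g x" and "Ck_on k S h"
  shows "Ck_on k S g"
  using assms(2,3)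
proof (induction k arbitrary: h g)
  case 0
  then show ?case
    using continuous_on_cong[of S S h g] by simp
next
  case (Suc k)
  have der: "(g has_derivative frechet_derivative h (at x)) (at x)" if "x \<in> S" for x
    using Suc.prems that
    by (intro has_derivative_transform_within_open[OF frechet_derivative_works' \<open>open S\<close>]) auto
  have "frechet_derivative h (at x) = frechet_derivative g (at x)" if "x \<in> S" for x
    using frechet_derivative_at[OF der[OF that]] by simp
  then have "Ck_on k S (\<lambda>x. frechet_derivative g (at x) v)" for v
    using Suc.prems(2) by - (rule Suc.IH[of "\<lambda>x. frechet_derivative h (at x) v"], auto)
  then show ?case
    using der by (auto simp: differentiable_def)
qed

text \<open>Lets an explicit formula for the derivative stand in for
  \<open>frechet_derivative\<close>, so that the closure properties below follow by induction on
  \<open>k\<close> from the usual rules of differentiation.\<close>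

lemma Ck_on_SucI:
  assumes "open S" and "\<And>x. x \<in> S \<Longrightarrow> (h has_derivative h' x) (at x)"
    and "\<And>v. Ck_on k S (\<lambda>x. h' x v)"
  shows "Ck_on (Suc k) S h"
proof -
  have "frechet_derivative h (at x) = h' x" if "x \<in> S" for x
    using frechet_derivative_at[OF assms(2)[OF that]] by simp
  then have "Ck_on k S (\<lambda>x. frechet_derivative h (at x) v)" for v
    by - (rule Ck_on_cong[OF \<open>open S\<close> _ assms(3)], auto)
  then show ?thesis
    using assms(2) by (auto simp: differentiable_def)
qed

lemma Ck_on_SucD:
  assumes "Ck_on (Suc k) S h"
  shows "x \<in> S \<Longrightarrow> (h has_derivative frechet_derivative h (at x)) (at x)"
    and "Ck_on k S (\<lambda>x. frechet_derivative h (at x) v)"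
  using assms by (auto intro: frechet_derivative_works')

lemma Ck_on_Suc_imp: "Ck_on (Suc k) S h \<Longrightarrow> Ck_on k S h"
proof (induction k arbitrary: h)
  case 0
  show ?case
    using Ck_on_imp_continuous_on[OF "0"] by simp
qed auto

lemma Ck_on_subset: "Ck_on k S h \<Longrightarrow> T \<subseteq> S \<Longrightarrow> Ck_on k T h"
  by (induction k arbitrary: h) (auto intro: continuous_on_subset)

lemma Ck_on_const: "open S \<Longrightarrow> Ck_on k S (\<lambda>_. a)"
proof (induction k arbitrary: a)
  case (Suc k)
  show ?case
    by (rule Ck_on_SucI[where h' = "\<lambda>_ _. 0"]) (use Suc in auto)
qed auto

lemma Ck_on_bounded_linear:
  assumes "open S" and "bounded_linear h"
  shows "Ck_on k S h"
proof (cases k)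
  case 0
  then show ?thesis
    using assms(2) by (simp add: linear_continuous_on)
next
  case (Suc k)
  show ?thesis
    unfolding Suc
    by (rule Ck_on_SucI[where h' = "\<lambda>_. h"])
      (use assms in \<open>auto intro: Ck_on_const bounded_linear_imp_has_derivative\<close>)
qed

lemma Ck_on_add:
  assumes "open S" and "Ck_on k S g" and "Ck_on k S h"
  shows "Ck_on k S (\<lambda>x. g x + h x)"
  using assms(2,3)
proof (induction k arbitrary: g h)
  case 0
  then show ?case
    by (simp add: continuous_on_add)
next
  case (Suc k)
  note D = Ck_on_SucD[OF Suc.prems(1)] Ck_on_SucD[OF Suc.prems(2)]
  show ?case
    by (rule Ck_on_SucI[OF \<open>open S\<close> has_derivative_add[OF D(1,3)]], assumption, assumption,
        rule Suc.IH[OF D(2,4)])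
qed

text \<open>One induction with the product rule serves scalar multiplication, real multiplication
  and the inner product alike.\<close>

lemma (in bounded_bilinear) Ck_on:
  fixes g :: "'e::euclidean_space \<Rightarrow> 'a"
  assumes "open S" and "Ck_on k S g" and "Ck_on k S h"
  shows "Ck_on k S (\<lambda>x. prod (g x) (h x))"
  using assms(2,3)
proof (induction k arbitrary: g h)
  case 0
  then show ?case
    by (simp add: continuous_on)
next
  case (Suc k)
  note D = Ck_on_SucD[OF Suc.prems(1)] Ck_on_SucD[OF Suc.prems(2)]
  show ?case
    by (rule Ck_on_SucI[OF \<open>open S\<close> FDERIV[OF D(1,3)]], assumption, assumption,
        rule Ck_on_add[OF \<open>open S\<close> Suc.IH[OF Ck_on_Suc_imp[OF Suc.prems(1)] D(4)]
          Suc.IH[OF D(2) Ck_on_Suc_imp[OF Suc.prems(2)]]])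
qed

lemma Ck_on_sum:
  assumes "open S" and "\<And>i. i \<in> B \<Longrightarrow> Ck_on k S (g i)"
  shows "Ck_on k S (\<lambda>x. \<Sum>i\<in>B. g i x)"
  using assms(2)
  by (induction B rule: infinite_finite_induct) (auto intro: Ck_on_add Ck_on_const \<open>open S\<close>)

lemma Ck_on_compose:
  fixes g :: "'a::euclidean_space \<Rightarrow> 'b::euclidean_space" and h :: "'b \<Rightarrow> 'c::real_normed_vector"
  assumes "open S" and "g ` S \<subseteq> T" and "Ck_on k S g" and "Ck_on k T h"
  shows "Ck_on k S (\<lambda>x. h (g x))"
  using assms(3,4)
proof (induction k arbitrary: h)
  case 0
  then show ?case
    using continuous_on_compose2[of T h S g] assms(2) by simp
next
  case (Suc k)
  note D = Ck_on_SucD[OF Suc.prems(1)] Ck_on_SucD[OF Suc.prems(2)]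
  \<comment> \<open>In the chain rule the argument of the outer derivative varies with
    \<open>x\<close>, while the induction hypothesis covers only fixed arguments. Expanding that
    argument in \<open>Basis\<close> separates the two dependencies.\<close>
  define h' where "h' x v = (\<Sum>b\<in>Basis. (frechet_derivative g (at x) v \<bullet> b) *\<^sub>R
      frechet_derivative h (at (g x)) b)" for x v
  have h': "frechet_derivative h (at (g x)) (frechet_derivative g (at x) v) = h' x v"
    if "x \<in> S" for x v
  proof -
    have lin: "linear (frechet_derivative h (at (g x)))"
      using D(3)[of "g x"] that assms(2) by (auto dest: has_derivative_linear)
    show ?thesis
      by (subst euclidean_representation[of "frechet_derivative g (at x) v", symmetric])
        (simp only: h'_def linear_sum[OF lin] linear_cmul[OF lin])
  qed
  show ?case
  proof (rule Ck_on_SucI[OF \<open>open S\<close>, where h' = h'])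
    fix x assume x: "x \<in> S"
    have "((\<lambda>x. h (g x)) has_derivative
        (\<lambda>v. frechet_derivative h (at (g x)) (frechet_derivative g (at x) v))) (at x)"
      using assms(2) x by (intro has_derivative_compose[OF D(1)] D(3)) auto
    then show "((\<lambda>x. h (g x)) has_derivative h' x) (at x)"
      using h'[OF x] by simp
  next
    fix v
    show "Ck_on k S (\<lambda>x. h' x v)"
      unfolding h'_def
      by (intro Ck_on_sum bounded_bilinear.Ck_on[OF bounded_bilinear_scaleR]
          bounded_bilinear.Ck_on[OF bounded_bilinear_inner] Ck_on_const \<open>open S\<close> D(2)
          Suc.IH[OF Ck_on_Suc_imp[OF Suc.prems(1)] D(4)])
  qed
qed

lemma Ck_on_inverse:
  fixes g :: "'a::euclidean_space \<Rightarrow> real"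
  assumes "open S" and "\<And>x. x \<in> S \<Longrightarrow> g x \<noteq> 0" and "Ck_on k S g"
  shows "Ck_on k S (\<lambda>x. inverse (g x))"
  using assms(3)
proof (induction k)
  case 0
  then show ?case
    using assms(2) by (auto intro: continuous_on_inverse)
next
  case (Suc k)
  note D = Ck_on_SucD[OF Suc.prems(1)]
  note inv = Suc.IH[OF Ck_on_Suc_imp[OF Suc.prems]]
  show ?case
  proof (rule Ck_on_SucI[OF \<open>open S\<close>])
    fix x assume "x \<in> S"
    then show "((\<lambda>x. inverse (g x)) has_derivative
        (\<lambda>v. - (inverse (g x) * frechet_derivative g (at x) v * inverse (g x)))) (at x)"
      by (intro Deriv.has_derivative_inverse assms(2) D(1))
  next
    fix v
    have "Ck_on k S (\<lambda>x. (- 1) * (inverse (g x) * frechet_derivative g (at x) v * inverse (g x)))"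
      by (intro bounded_bilinear.Ck_on[OF bounded_bilinear_mult] inv D(2) \<open>open S\<close> Ck_on_const)
    then show "Ck_on k S (\<lambda>x. - (inverse (g x) * frechet_derivative g (at x) v * inverse (g x)))"
      by simp
  qed
qed

section \<open>Closure properties of smooth functions\<close>

lemma smooth_on_imp_continuous_on: "smooth_on S h \<Longrightarrow> continuous_on S h"
  using Ck_on_imp_continuous_on unfolding smooth_on_def by blast

lemma smooth_on_has_derivative:
  "smooth_on S h \<Longrightarrow> x \<in> S \<Longrightarrow> (h has_derivative frechet_derivative h (at x)) (at x)"
  unfolding smooth_on_def using Ck_on_SucD(1) by blast

lemma smooth_on_frechet_derivative:
  "smooth_on S h \<Longrightarrow> smooth_on S (\<lambda>x. frechet_derivative h (at x) v)"
  unfolding smooth_on_def using Ck_on_SucD(2) by blast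

lemma smooth_on_if_derivative:
  assumes "open S" and "\<And>x. x \<in> S \<Longrightarrow> (h has_derivative h' x) (at x)"
    and "\<And>v. smooth_on S (\<lambda>x. h' x v)"
  shows "smooth_on S h"
  unfolding smooth_on_def
proof
  fix k
  show "Ck_on k S h"
    using assms(3) by (intro Ck_on_Suc_imp[OF Ck_on_SucI[OF assms(1,2)]]) (auto simp: smooth_on_def)
qed

lemma smooth_on_cong:
  "open S \<Longrightarrow> (\<And>x. x \<in> S \<Longrightarrow> h x = g x) \<Longrightarrow> smooth_on S h \<Longrightarrow> smooth_on S g"
  unfolding smooth_on_def using Ck_on_cong by blast

lemma smooth_on_subset: "smooth_on S h \<Longrightarrow> T \<subseteq> S \<Longrightarrow> smooth_on T h"
  unfolding smooth_on_def using Ck_on_subset by blast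

lemma smooth_on_const: "open S \<Longrightarrow> smooth_on S (\<lambda>_. a)"
  unfolding smooth_on_def using Ck_on_const by blast

lemma smooth_on_bounded_linear: "open S \<Longrightarrow> bounded_linear h \<Longrightarrow> smooth_on S h"
  unfolding smooth_on_def using Ck_on_bounded_linear by blast

lemma smooth_on_add:
  "open S \<Longrightarrow> smooth_on S g \<Longrightarrow> smooth_on S h \<Longrightarrow> smooth_on S (\<lambda>x. g x + h x)"
  unfolding smooth_on_def using Ck_on_add by blast

lemma smooth_on_scaleR:
  "open S \<Longrightarrow> smooth_on S g \<Longrightarrow> smooth_on S h \<Longrightarrow> smooth_on S (\<lambda>x. g x *\<^sub>R h x)"
  unfolding smooth_on_def using bounded_bilinear.Ck_on[OF bounded_bilinear_scaleR] by blast

lemma smooth_on_mult: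
  fixes g h :: "'a::euclidean_space \<Rightarrow> real"
  shows "open S \<Longrightarrow> smooth_on S g \<Longrightarrow> smooth_on S h \<Longrightarrow> smooth_on S (\<lambda>x. g x * h x)"
  using smooth_on_scaleR[of S g h] by simp

lemma smooth_on_minus: "open S \<Longrightarrow> smooth_on S h \<Longrightarrow> smooth_on S (\<lambda>x. - h x)"
  using smooth_on_scaleR[of S "\<lambda>_. - 1" h] by (simp add: smooth_on_const)

lemma smooth_on_diff:
  "open S \<Longrightarrow> smooth_on S g \<Longrightarrow> smooth_on S h \<Longrightarrow> smooth_on S (\<lambda>x. g x - h x)"
  using smooth_on_add[of S g "\<lambda>x. - h x"] by (simp add: smooth_on_minus)

lemma smooth_on_power:
  fixes h :: "'a::euclidean_space \<Rightarrow> real"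
  shows "open S \<Longrightarrow> smooth_on S h \<Longrightarrow> smooth_on S (\<lambda>x. h x ^ n)"
  by (induction n) (auto intro: smooth_on_mult smooth_on_const)

lemma smooth_on_sum:
  "open S \<Longrightarrow> (\<And>i. i \<in> B \<Longrightarrow> smooth_on S (g i)) \<Longrightarrow> smooth_on S (\<lambda>x. \<Sum>i\<in>B. g i x)"
  using Ck_on_sum[of S B _ g] by (simp add: smooth_on_def)

lemma smooth_on_compose:
  fixes g :: "'a::euclidean_space \<Rightarrow> 'b::euclidean_space"
  shows "smooth_on T h \<Longrightarrow> smooth_on S g \<Longrightarrow> open S \<Longrightarrow> g ` S \<subseteq> T \<Longrightarrow> smooth_on S (\<lambda>x. h (g x))"
  using Ck_on_compose[of S g T _ h] by (simp add: smooth_on_def)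

lemma smooth_on_divide:
  fixes g h :: "'a::euclidean_space \<Rightarrow> real"
  shows "open S \<Longrightarrow> smooth_on S g \<Longrightarrow> smooth_on S h \<Longrightarrow> (\<And>x. x \<in> S \<Longrightarrow> h x \<noteq> 0)
    \<Longrightarrow> smooth_on S (\<lambda>x. g x / h x)"
  unfolding divide_inverse
  by (intro smooth_on_mult) (auto simp: smooth_on_def intro: Ck_on_inverse)

lemma smooth_on_DERIV:
  fixes h :: "real \<Rightarrow> real"
  assumes "open S" and "\<And>x. x \<in> S \<Longrightarrow> (h has_real_derivative h' x) (at x)" and "smooth_on S h'"
  shows "smooth_on S h"
proof (rule smooth_on_if_derivative[OF \<open>open S\<close>])
  fix x assume "x \<in> S"
  then show "(h has_derivative (*) (h' x)) (at x)"
    using assms(2) by (simp add: has_field_derivative_def)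
next
  fix v
  show "smooth_on S (\<lambda>x. h' x * v)"
    using assms by (intro smooth_on_mult smooth_on_const)
qed

lemma smooth_on_deriv:
  fixes h :: "real \<Rightarrow> real"
  assumes "smooth_on S h" and "x \<in> S"
  shows "(h has_real_derivative deriv h x) (at x)"
  using smooth_on_has_derivative[OF assms]
  unfolding DERIV_deriv_iff_real_differentiable differentiable_def by blast

lemma smooth_on_deriv_smooth:
  fixes h :: "real \<Rightarrow> real"
  assumes "open S" and "smooth_on S h"
  shows "smooth_on S (deriv h)"
proof (rule smooth_on_cong[OF \<open>open S\<close> _ smooth_on_frechet_derivative[OF assms(2), where v = 1]])
  fix x assume "x \<in> S"
  then have "(h has_derivative (*) (deriv h x)) (at x)"
    using smooth_on_deriv[OF assms(2)] by (simp add: has_field_derivative_def)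
  then show "frechet_derivative h (at x) 1 = deriv h x"
    using frechet_derivative_at[of h "(*) (deriv h x)" x] by (metis mult.right_neutral)
qed

section \<open>Integrals with variable upper limit\<close>

lemma DERIV_interval_integral:
  fixes g :: "real \<Rightarrow> real"
  assumes "continuous_on UNIV g"
  shows "((\<lambda>x. LBINT \<tau>=0..x. g \<tau>) has_real_derivative g x) (at x)"
proof -
  \<comment> \<open>The margin 1 puts \<open>x\<close> in the interior of \<open>{a..b}\<close>
    whatever its sign, so the derivative within the interval is a derivative at
    \<open>x\<close>.\<close>
  define a b where "a = min 0 x - 1" and "b = max 0 x + 1"
  have "((\<lambda>u. LBINT \<tau>=0..u. g \<tau>) has_vector_derivative g x) (at x within {a..b})"
    using interval_integral_FTC2[of a 0 b g x] continuous_on_subset[OF assms]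
    by (simp add: a_def b_def zero_ereal_def)
  moreover have "at x within {a..b} = at x"
    by (rule at_within_interior) (auto simp: a_def b_def)
  ultimately show ?thesis
    by (simp add: has_real_derivative_iff_has_vector_derivative)
qed

lemma smooth_on_interval_integral:
  fixes g :: "real \<Rightarrow> real"
  assumes "smooth_on UNIV g"
  shows "smooth_on UNIV (\<lambda>x. LBINT \<tau>=0..x. g \<tau>)"
  by (rule smooth_on_DERIV[OF open_UNIV DERIV_interval_integral assms])
    (rule smooth_on_imp_continuous_on[OF assms])

section \<open>Split two-forms\<close>

lemma act_simps [simp]:
  "act a 0 = 0" "act a (u + v) = act a u + act a v" "act a (u - v) = act a u - act a v"
  "act a (- u) = - act a u" "act a (t *\<^sub>R u) = t * act a u"
  "act b (frame (Inl a)) = (if b = a then 1 else 0)" "act b (frame (Inr a)) = 0"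
  by (auto simp: act_def frame_def axis_def)

lemma ang_simps [simp]:
  "ang a 0 = 0" "ang a (u + v) = ang a u + ang a v" "ang a (u - v) = ang a u - ang a v"
  "ang a (- u) = - ang a u" "ang a (t *\<^sub>R u) = t * ang a u"
  "ang b (frame (Inl a)) = 0" "ang b (frame (Inr a)) = (if b = a then 1 else 0)"
  by (auto simp: ang_def frame_def axis_def)

lemma linear_act: "linear (act a)" and linear_ang: "linear (ang a)"
  by (intro linearI; simp)+

lemma act_sum [simp]: "act a (sum g B) = (\<Sum>b\<in>B. act a (g b))"
  and ang_sum [simp]: "ang a (sum g B) = (\<Sum>b\<in>B. ang a (g b))"
  using linear_sum[OF linear_act] linear_sum[OF linear_ang] by auto

lemma phase_eqI:
  assumes "\<And>a. act a u = act a v" and "\<And>a. ang a u = ang a v"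
  shows "u = v"
  using assms by (auto simp: act_def ang_def vec_eq_iff prod_eq_iff)

lemma phase_expansion:
  "v = (\<Sum>a\<in>UNIV. act a v *\<^sub>R frame (Inl a) + ang a v *\<^sub>R frame (Inr a))"
  by (rule phase_eqI) (simp_all add: mult_delta_right)

lemma linear_phase_expansion:
  fixes L :: "'n::finite phase \<Rightarrow> real"
  assumes "linear L"
  shows "L v = (\<Sum>a\<in>UNIV. act a v * L (frame (Inl a)) + ang a v * L (frame (Inr a)))"
  by (subst phase_expansion[of v])
    (simp add: linear_sum[OF assms] linear_add[OF assms] linear_cmul[OF assms])

lemma linear_phase_eqI:
  fixes L L' :: "'n::finite phase \<Rightarrow> real"
  assumes "linear L" and "linear L'"
    and "\<And>a. L (frame (Inl a)) = L' (frame (Inl a))"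
    and "\<And>a. L (frame (Inr a)) = L' (frame (Inr a))"
  shows "L = L'"
proof
  fix v
  show "L v = L' v"
    using linear_phase_expansion[OF assms(1), of v] linear_phase_expansion[OF assms(2), of v]
      assms(3,4) by simp
qed

text \<open>The common shape of all forms in the proof, with P = \<open>modular_poly m c\<close>:
  the weight \<open>w\<close> is K P(x) / x^m for \<open>\<omega>\<close> off Z, K P(x) for its
  matrix in the b^m-frame, and f_eps'(x) K P(x) for the desingularized form.\<close>

definition split_form :: "'n::finite \<Rightarrow> real \<Rightarrow> 'n phase \<Rightarrow> 'n phase \<Rightarrow> real" where
  "split_form r w u v = w * wedge (act r) (ang r) u v + laurent_beta r u v"

lemma split_form_linear_right: "linear (split_form r w u)"
  by (rule linearI)
    (auto simp: split_form_def laurent_beta_def wedge_def algebra_simps sum.distrib sum_subtractf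
      sum_distrib_left)

lemma split_form_alternating: "split_form r w u v = - split_form r w v u"
  unfolding split_form_def laurent_beta_def wedge_def
  by (simp only: minus_add_distrib sum_negf[symmetric] minus_diff_eq mult_minus_right[symmetric])

lemma split_form_self [simp]: "split_form r w u u = 0"
  using split_form_alternating[of r w u u] by simp

lemma split_form_linear_left: "linear (\<lambda>u. split_form r w u v)"
  by (subst split_form_alternating) (intro linear_compose_neg split_form_linear_right)

lemma split_form_diff_left: "split_form r w (u - u') v = split_form r w u v - split_form r w u' v"
  using linear_diff[OF split_form_linear_left] by metis

lemma split_form_frame_right [simp]:
  "split_form r w u (frame (Inl a)) = - (if a = r then w else 1) * ang a u"
  "split_form r w u (frame (Inr a)) = (if a = r then w else 1) * act a u"
  by (auto simp: split_form_def laurent_beta_def wedge_def mult_delta_right mult_delta_left sum_negf sum_subtractf)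

lemma split_form_nondegenerate:
  assumes "w \<noteq> 0" and "\<And>v. split_form r w u v = 0"
  shows "u = 0"
proof (rule phase_eqI)
  fix a
  show "act a u = act a 0"
    using assms(1) assms(2)[of "frame (Inr a)"] by (auto split: if_splits)
  show "ang a u = ang a 0"
    using assms(1) assms(2)[of "frame (Inl a)"] by (auto split: if_splits)
qed

text \<open>
  The Hamiltonian vector of a covector \<open>L\<close> annihilating \<open>\<partial>\<phi>\<^sub>r\<close>. The angular velocity \<open>s\<close> is kept as
  a separate argument because it is determined by \<open>w s = L (\<partial>I\<^sub>r)\<close> only where \<open>w \<noteq> 0\<close>.
\<close>

definition ham_vec :: "'n::finite \<Rightarrow> real \<Rightarrow> ('n phase \<Rightarrow> real) \<Rightarrow> 'n phase" where
  "ham_vec r s L = ((\<chi> a. if a = r then 0 else - L (frame (Inr a))),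
     (\<chi> a. if a = r then s else L (frame (Inl a))))"

lemma act_ham_vec [simp]: "act a (ham_vec r s L) = (if a = r then 0 else - L (frame (Inr a)))"
  and ang_ham_vec [simp]: "ang a (ham_vec r s L) = (if a = r then s else L (frame (Inl a)))"
  by (auto simp: ham_vec_def act_def ang_def)

lemma split_form_ham_vec:
  assumes "linear L" and "w * s = L (frame (Inl r))" and "L (frame (Inr r)) = 0"
  shows "split_form r w (ham_vec r s L) v = - L v"
proof -
  have "split_form r w (ham_vec r s L) = (\<lambda>v. - L v)"
    by (rule linear_phase_eqI)
      (use assms in \<open>auto intro: split_form_linear_right linear_compose_neg\<close>)
  then show ?thesis
    by simp
qed

lemma split_form_eq_ham_vec:
  assumes "w \<noteq> 0" and "linear L" and "L (frame (Inr r)) = 0"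
    and "\<And>v. split_form r w u v = - L v"
  shows "u = ham_vec r (L (frame (Inl r)) / w) L"
proof -
  have "u - ham_vec r (L (frame (Inl r)) / w) L = 0"
    by (rule split_form_nondegenerate[OF \<open>w \<noteq> 0\<close>, of r])
      (simp add: split_form_diff_left split_form_ham_vec assms)
  then show ?thesis
    by simp
qed

text \<open>Up to sign convention the Poisson bracket of the space reduced by the circle action
  along \<phi>_r. The weight of the pair \<open>r\<close> does not enter it, which is why
  commutation passes from one form to the other.\<close>

definition reduced_bracket ::
  "'n::finite \<Rightarrow> ('n phase \<Rightarrow> real) \<Rightarrow> ('n phase \<Rightarrow> real) \<Rightarrow> real" where
  "reduced_bracket r L L' = (\<Sum>a\<in>UNIV - {r}.
     L (frame (Inr a)) * L' (frame (Inl a)) - L (frame (Inl a)) * L' (frame (Inr a)))"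

lemma split_form_ham_vec_ham_vec:
  "split_form r w (ham_vec r s L) (ham_vec r s' L') = - reduced_bracket r L L'"
  unfolding split_form_def laurent_beta_def wedge_def reduced_bracket_def sum_negf[symmetric]
  by (auto intro!: sum.cong)

section \<open>The top power of a split two-form\<close>

text \<open>Exchanges the members of each pair indexed by \<open>B\<close>. Together with the maps
  \<open>map_sum \<pi> \<pi>\<close> these involutions generate the permutations that respect the
  pairs, the hyperoctahedral group.\<close>

definition swap_pairs :: "'n set \<Rightarrow> 'n + 'n \<Rightarrow> 'n + 'n" where
  "swap_pairs B x = (case x of Inl a \<Rightarrow> if a \<in> B then Inr a else Inl a
     | Inr a \<Rightarrow> if a \<in> B then Inl a else Inr a)"

lemma bij_permutation: "bij (p :: 'a::finite \<Rightarrow> 'a) \<Longrightarrow> permutation p"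
  by (auto simp: permutation)

lemma swap_pairs_insert:
  "a \<notin> B \<Longrightarrow> swap_pairs (insert a B) = Transposition.transpose (Inl a) (Inr a) \<circ> swap_pairs B"
  by (auto simp: fun_eq_iff swap_pairs_def Transposition.transpose_def split: sum.splits)

lemma permutation_swap_pairs: "permutation (swap_pairs B :: 'n::finite + 'n \<Rightarrow> 'n + 'n)"
  by (rule bij_permutation, rule o_bij[where g = "swap_pairs B"])
    (auto simp: fun_eq_iff swap_pairs_def split: sum.splits)

lemma sign_swap_pairs:
  "sign (swap_pairs B :: 'n::finite + 'n \<Rightarrow> 'n + 'n) = (-1) ^ card B"
proof -
  have "finite B" by simp
  then show ?thesis
  proof (induction B rule: finite_induct)
    case empty
    have "swap_pairs {} = (id :: 'n + 'n \<Rightarrow> 'n + 'n)"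
      by (auto simp: fun_eq_iff swap_pairs_def split: sum.splits)
    then show ?case
      by (simp add: sign_id)
  next
    case (insert a B)
    have "sign (swap_pairs (insert a B)) =
        sign (Transposition.transpose (Inl a) (Inr a)) * sign (swap_pairs B)"
      unfolding swap_pairs_insert[OF insert.hyps(2)]
      by (intro sign_compose permutation_swap_pairs permutation_swap_id)
    then show ?case
      using insert by (simp add: sign_swap_id)
  qed
qed

text \<open>Permuting the pairs is even: the two copies of \<open>\<pi>\<close> are conjugate by the exchange of summands.\<close>

lemma
  fixes \<pi> :: "'n::finite \<Rightarrow> 'n"
  assumes "bij \<pi>"
  shows permutation_map_sum: "permutation (map_sum \<pi> \<pi>)"
    and sign_map_sum: "sign (map_sum \<pi> \<pi>) = 1"
proof -
  define l where "l = map_sum \<pi> (id :: 'n \<Rightarrow> 'n)"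
  define e where "e = (case_sum Inr Inl :: 'n + 'n \<Rightarrow> 'n + 'n)"
  have "l \<circ> map_sum (inv \<pi>) id = id" "map_sum (inv \<pi>) id \<circ> l = id"
    using bij_is_surj[OF assms, unfolded surj_iff] bij_is_inj[OF assms, unfolded inj_iff]
    by (simp_all add: l_def map_sum.comp map_sum.id)
  then have l: "permutation l"
    by (intro bij_permutation o_bij)
  have "e \<circ> e = id"
    by (auto simp: fun_eq_iff e_def split: sum.splits)
  then have e: "permutation e"
    by (intro bij_permutation o_bij)
  have eq: "map_sum \<pi> \<pi> = l \<circ> (e \<circ> (l \<circ> e))"
    by (auto simp: fun_eq_iff l_def e_def map_sum_def split: sum.splits)
  show "permutation (map_sum \<pi> \<pi>)"
    unfolding eq by (intro permutation_compose l e)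
  have "sign (map_sum \<pi> \<pi>) = (sign l * sign l) * (sign e * sign e)"
    unfolding eq by (simp only: sign_compose permutation_compose l e mult_ac)
  then show "sign (map_sum \<pi> \<pi>) = 1"
    by simp
qed

definition preserves_pairs :: "('n + 'n \<Rightarrow> 'n + 'n) \<Rightarrow> bool" where
  "preserves_pairs \<sigma> \<longleftrightarrow> (\<forall>a. \<exists>b. {\<sigma> (Inl a), \<sigma> (Inr a)} = {Inl b, Inr b})"

lemma split_form_frame_frame:
  "split_form r w (frame (Inl a)) (frame (Inl b)) = 0"
  "split_form r w (frame (Inr a)) (frame (Inr b)) = 0"
  "split_form r w (frame (Inl a)) (frame (Inr b)) = (if a = b then if a = r then w else 1 else 0)"
  "split_form r w (frame (Inr a)) (frame (Inl b)) = (if a = b then - (if a = r then w else 1) else 0)"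
  by auto

text \<open>A permutation that breaks a pair produces a zero factor. Otherwise it permutes the pairs
  and swaps those in some set \<open>B\<close>: each swap gives -1 by antisymmetry and the sign of
  the permutation is (-1)^|B|, so the signs cancel. The weight occurs once, from the single pair
  sent to the pair \<open>r\<close>.\<close>

lemma top_power_summand:
  fixes \<sigma> :: "'n::finite + 'n \<Rightarrow> 'n + 'n"
  assumes "\<sigma> permutes UNIV"
  shows "of_int (sign \<sigma>) * (\<Prod>a\<in>UNIV. split_form r w (frame (\<sigma> (Inl a))) (frame (\<sigma> (Inr a)))) =
    (if preserves_pairs \<sigma> then w else 0)"
proof (cases "preserves_pairs \<sigma>")
  case False
  then obtain a where a: "\<And>b. {\<sigma> (Inl a), \<sigma> (Inr a)} \<noteq> {Inl b, Inr b}"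
    by (auto simp: preserves_pairs_def)
  have "split_form r w (frame (\<sigma> (Inl a))) (frame (\<sigma> (Inr a))) = 0"
    by (cases "\<sigma> (Inl a)"; cases "\<sigma> (Inr a)")
      (use a in \<open>auto simp: split_form_frame_frame simp del: split_form_frame_right\<close>)
  then show ?thesis
    using False by (auto intro!: prod_zero)
next
  case True
  then obtain \<pi> where \<pi>: "\<And>a. {\<sigma> (Inl a), \<sigma> (Inr a)} = {Inl (\<pi> a), Inr (\<pi> a)}"
    by (auto simp: preserves_pairs_def) metis
  define B where "B = {a. \<sigma> (Inl a) = Inr (\<pi> a)}"
  have \<sigma>B: "\<sigma> (Inl a) = (if a \<in> B then Inr (\<pi> a) else Inl (\<pi> a))"
    "\<sigma> (Inr a) = (if a \<in> B then Inl (\<pi> a) else Inr (\<pi> a))" for a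
    using \<pi>[of a] by (auto simp: B_def doubleton_eq_iff)
  have "inj \<sigma>"
    using assms permutes_inj by blast
  have "inj \<pi>"
  proof (rule injI)
    fix a b assume "\<pi> a = \<pi> b"
    then have "\<sigma> (Inl a) \<in> {\<sigma> (Inl b), \<sigma> (Inr b)}"
      using \<pi>[of a] \<pi>[of b] by auto
    then show "a = b"
      using \<open>inj \<sigma>\<close> by (auto dest: injD)
  qed
  then have "bij \<pi>"
    by (simp add: bij_def finite_UNIV_inj_surj)
  have "\<sigma> = map_sum \<pi> \<pi> \<circ> swap_pairs B"
    by (auto simp: fun_eq_iff swap_pairs_def \<sigma>B split: sum.splits)
  then have "sign \<sigma> = (-1) ^ card B"
    by (simp add: sign_compose permutation_map_sum sign_map_sum \<open>bij \<pi>\<close> permutation_swap_pairs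
        sign_swap_pairs)
  moreover have "(\<Prod>a\<in>UNIV. split_form r w (frame (\<sigma> (Inl a))) (frame (\<sigma> (Inr a)))) =
      (\<Prod>a\<in>UNIV. if a \<in> B then -1 else 1) * (\<Prod>a\<in>UNIV. if \<pi> a = r then w else 1)"
    unfolding prod.distrib[symmetric]
    by (rule prod.cong) (simp_all add: \<sigma>B split_form_frame_frame del: split_form_frame_right)
  moreover have "(\<Prod>a\<in>UNIV. if a \<in> B then -1 else 1 :: real) = (-1) ^ card B"
    by (simp add: prod.If_cases)
  moreover have "(\<Prod>a\<in>UNIV. if \<pi> a = r then w else 1) = (\<Prod>a\<in>UNIV. if a = r then w else 1)"
    by (rule prod.reindex_bij_betw[OF \<open>bij \<pi>\<close>, of "\<lambda>a. if a = r then w else 1"])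
  ultimately show ?thesis
    using True by (simp add: power_mult_distrib[symmetric])
qed

text \<open>The constant is the number of pair-preserving permutations over 2^n, and the identity is
  one of them. It is chosen before the form and the point, so that the top power can be
  differentiated as a constant times the weight.\<close>

lemma top_power_split_form:
  "\<exists>C\<noteq>0. \<forall>\<omega> w. \<forall>p :: 'n::finite phase. \<omega> p = split_form r w \<longrightarrow> top_power \<omega> p = C * w"
proof (intro exI conjI allI impI)
  let ?P = "{\<sigma> :: 'n + 'n \<Rightarrow> 'n + 'n. \<sigma> permutes UNIV}"
  let ?C = "real (card {\<sigma> \<in> ?P. preserves_pairs \<sigma>}) / 2 ^ CARD('n)"
  have fin: "finite ?P"
    by (simp add: finite_permutations)
  have "id \<in> {\<sigma> \<in> ?P. preserves_pairs \<sigma>}"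
    by (auto simp: preserves_pairs_def permutes_id)
  then show "?C \<noteq> 0"
    using fin by (subst divide_eq_0_iff, subst of_nat_eq_0_iff, subst card_0_eq) (auto intro!: exI[of _ id])
  show "top_power \<omega> p = ?C * w" if "\<omega> p = split_form r w" for \<omega> p w
  proof -
    have "top_power \<omega> p = (\<Sum>\<sigma>\<in>?P. if preserves_pairs \<sigma> then w else 0) / 2 ^ CARD('n)"
      unfolding top_power_def that
      by (intro arg_cong2[where f = "(/)"] sum.cong) (auto simp: top_power_summand)
    also have "\<dots> = ?C * w"
      using fin by (simp add: sum.If_cases Int_def)
    finally show ?thesis .
  qed
qed

section \<open>Calculus on the phase space\<close>

lemma bounded_linear_act: "bounded_linear (act a)" and bounded_linear_ang: "bounded_linear (ang a)"
  by (simp_all add: linear_conv_bounded_linear[symmetric] linear_act linear_ang)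

lemmas continuous_on_act [continuous_intros] = bounded_linear.continuous_on[OF bounded_linear_act]
  and continuous_on_ang [continuous_intros] = bounded_linear.continuous_on[OF bounded_linear_ang]

lemma angle_shift: "(0, axis a (2 * pi)) = (2 * pi) *\<^sub>R frame (Inr a)"
  by (rule phase_eqI) (simp_all add: act_def ang_def frame_def axis_def)

lemma act_anchor [simp]: "act a (anchor r m p v) = (if a = r then act r p ^ m * act r v else act a v)"
  and ang_anchor [simp]: "ang a (anchor r m p v) = ang a v"
  by (auto simp: anchor_def act_def ang_def)

lemma open_minus_hypersurface: "open S \<Longrightarrow> open (S - hypersurface r)"
  unfolding hypersurface_def
  by (intro open_Diff closed_Collect_eq continuous_intros) auto

text \<open>The complement of Z is dense in an open set: moving from a point of Z along the
  direction I_r leaves Z at once. This is the device that extends identities of b^m-objects across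
  Z.\<close>

lemma eq_off_hypersurface:
  fixes g h :: "'n::finite phase \<Rightarrow> 'b::t2_space"
  assumes "open S" and "continuous_on S g" and "continuous_on S h"
    and "\<And>p. p \<in> S - hypersurface r \<Longrightarrow> g p = h p" and "p \<in> S"
  shows "g p = h p"
proof (cases "p \<in> hypersurface r")
  case False
  then show ?thesis
    using assms by simp
next
  case True
  define y where "y t = p + t *\<^sub>R frame (Inl r)" for t :: real
  have y: "(y \<longlongrightarrow> p) (at 0)"
    unfolding y_def by (auto intro!: tendsto_eq_intros)
  have "(\<lambda>t. g (y t)) \<midarrow>0\<rightarrow> g p" "(\<lambda>t. h (y t)) \<midarrow>0\<rightarrow> h p"
    using assms(1,2,3,5) y by (auto simp: continuous_on_eq_continuous_at intro: isCont_tendsto_compose)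
  moreover have "eventually (\<lambda>t. y t \<in> S) (at 0)"
    using topological_tendstoD[OF y assms(1,5)] .
  then have "eventually (\<lambda>t. g (y t) = h (y t)) (at 0)"
    using eventually_neq_at_within[of 0 0 UNIV]
    by eventually_elim (use True in \<open>auto intro!: assms(4) simp: y_def hypersurface_def\<close>)
  ultimately show ?thesis
    using tendsto_unique[of "at 0" "\<lambda>t. h (y t)" "g p" "h p"]
    by (simp add: tendsto_cong)
qed

lemma smooth_on_has_differential:
  "smooth_on S h \<Longrightarrow> p \<in> S \<Longrightarrow> (h has_derivative differential h p) (at p)"
  unfolding differential_def by (rule smooth_on_has_derivative)

lemma differential_eqI: "(h has_derivative L) (at p) \<Longrightarrow> differential h p = L"
  unfolding differential_def by (rule frechet_derivative_at[symmetric])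

lemma linear_differential: "smooth_on S h \<Longrightarrow> p \<in> S \<Longrightarrow> linear (differential h p)"
  using smooth_on_has_differential has_derivative_linear by blast

lemma smooth_on_differential: "smooth_on S h \<Longrightarrow> smooth_on S (\<lambda>p. differential h p v)"
  unfolding differential_def by (rule smooth_on_frechet_derivative)

lemma continuous_on_differential: "smooth_on S h \<Longrightarrow> continuous_on S (\<lambda>p. differential h p v)"
  by (intro smooth_on_imp_continuous_on smooth_on_differential)

text \<open>Serves two invariances: the period 2 pi in every angle, and arbitrary translations along
  \<phi>_r.\<close>

lemma differential_translate:
  assumes "open S" and "\<And>q. q \<in> S \<Longrightarrow> q + \<tau> \<in> S \<and> h (q + \<tau>) = h q" and "smooth_on S h" and "q \<in> S"
  shows "differential h (q + \<tau>) = differential h q"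
proof -
  have "(h has_derivative differential h (q + \<tau>)) (at (q + \<tau>))"
    using smooth_on_has_differential[OF assms(3)] assms(2)[OF assms(4)] by simp
  then have "((\<lambda>q. h (q + \<tau>)) has_derivative differential h (q + \<tau>)) (at q)"
    using has_derivative_compose[of "\<lambda>q. q + \<tau>" "\<lambda>v. v" q UNIV h]
    by (simp add: has_derivative_add_const)
  then have "(h has_derivative differential h (q + \<tau>)) (at q)"
    by (rule has_derivative_transform_within_open[OF _ \<open>open S\<close> \<open>q \<in> S\<close>]) (use assms(2) in blast)
  then show ?thesis
    by (rule differential_eqI[symmetric])
qed

lemma smooth_on_phaseI:
  assumes "open S" and "\<And>a. smooth_on S (\<lambda>p. act a (X p))" and "\<And>a. smooth_on S (\<lambda>p. ang a (X p))"
  shows "smooth_on S X"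
proof -
  have "smooth_on S (\<lambda>p. \<Sum>a\<in>UNIV. act a (X p) *\<^sub>R frame (Inl a) + ang a (X p) *\<^sub>R frame (Inr a))"
    by (intro smooth_on_sum smooth_on_add smooth_on_scaleR smooth_on_const assms)
  then show ?thesis
    by (simp add: phase_expansion[symmetric])
qed

lemma smooth_on_act: "open S \<Longrightarrow> smooth_on S (act a)"
  by (intro smooth_on_bounded_linear bounded_linear_act)

lemma smooth_on_compose_act:
  assumes "smooth_on UNIV g" and "open S"
  shows "smooth_on S (\<lambda>p. g (act a p))"
  by (rule smooth_on_compose[OF assms(1) smooth_on_act[OF assms(2)] assms(2)]) simp

section \<open>The desingularization profile\<close>

text \<open>The definition gives positivity only on [-1,1]. For x > 1 the explicit formula
  differentiates to x^(-2k), and x < -1 follows because the derivative of an odd function is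
  even.\<close>

lemma even_profile_deriv_pos:
  assumes "k \<ge> 1" and "even_profile k F"
  shows "deriv F x > 0"
proof -
  have F: "(F has_real_derivative deriv F x) (at x)" for x
    using assms(2) smooth_on_deriv[of UNIV] by (simp add: even_profile_def)
  have pos: "deriv F x > 0" if "x \<ge> -1" for x
  proof (cases "x \<le> 1")
    case True
    then show ?thesis
      using assms(2) that by (simp add: even_profile_def)
  next
    case False
    define n where "n = 2 * k - 1"
    have "n > 0"
      using assms(1) by (simp add: n_def)
    have "((\<lambda>y. - 1 / (real n * y ^ n) + 2) has_real_derivative
        real n * (real n * x ^ (n - 1)) / (real n * x ^ n)\<^sup>2) (at x)"
      using False \<open>n > 0\<close> by (auto intro!: derivative_eq_intros simp: power2_eq_square)
    then have "(F has_real_derivative real n * (real n * x ^ (n - 1)) / (real n * x ^ n)\<^sup>2) (at x)"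
      using False assms(2)
      by (rule_tac has_field_derivative_transform_within_open[of _ _ _ "{1<..}"])
        (auto simp: even_profile_def n_def)
    then have "deriv F x = real n * (real n * x ^ (n - 1)) / (real n * x ^ n)\<^sup>2"
      by (rule DERIV_imp_deriv)
    then show ?thesis
      using False \<open>n > 0\<close> by simp
  qed
  have "((\<lambda>y. F (- y)) has_real_derivative - deriv F (- x)) (at x)"
    using F[of "- x"] by (simp add: DERIV_mirror)
  moreover have "(\<lambda>y. F (- y)) = (\<lambda>y. - F y)"
    using assms(2) by (auto simp: even_profile_def)
  ultimately have "deriv F (- x) = deriv F x"
    using DERIV_unique[OF DERIV_minus[OF F[of x]], of "- deriv F (- x)"] by simp
  then show ?thesis
    using pos[of x] pos[of "- x"] by (cases "x \<ge> -1") auto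
qed

text \<open>The derivative of an even function is odd, so the sign prescribed on the negative axis
  determines the one on the positive axis.\<close>

lemma odd_profile_deriv_pos:
  assumes "odd_profile k F"
  shows "x < 0 \<Longrightarrow> deriv F x < 0" and "x > 0 \<Longrightarrow> deriv F x > 0"
proof -
  have F: "(F has_real_derivative deriv F x) (at x)" for x
    using assms smooth_on_deriv[of UNIV] by (simp add: odd_profile_def)
  have "((\<lambda>y. F (- y)) has_real_derivative - deriv F (- x)) (at x)"
    using F[of "- x"] by (simp add: DERIV_mirror)
  moreover have "(\<lambda>y. F (- y)) = F"
    using assms by (auto simp: odd_profile_def)
  ultimately have "deriv F x = - deriv F (- x)"
    using DERIV_unique[OF F[of x]] by simp
  then show "x < 0 \<Longrightarrow> deriv F x < 0" and "x > 0 \<Longrightarrow> deriv F x > 0"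
    using assms by (auto simp: odd_profile_def)
qed

text \<open>The quadratic coefficient is left free by the profile, but it cannot vanish, since F' is
  positive at 1/2. This simple zero of F' is the origin of the transversality of the fold.\<close>

lemma odd_profile_deriv_linear:
  assumes "odd_profile k F"
  obtains a where "a \<noteq> 0" and "\<And>x. \<bar>x\<bar> < 1 \<Longrightarrow> deriv F x = a * x"
proof -
  obtain a b where ab: "\<And>x. x \<in> {-1..1} \<Longrightarrow> F x = a * x\<^sup>2 + b"
    using assms by (auto simp: odd_profile_def)
  have lin: "deriv F x = 2 * a * x" if "\<bar>x\<bar> < 1" for x
  proof (rule DERIV_imp_deriv)
    have "((\<lambda>x. a * x\<^sup>2 + b) has_real_derivative 2 * a * x) (at x)"
      by (auto intro!: derivative_eq_intros)
    then show "(F has_real_derivative 2 * a * x) (at x)"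
      using that ab
      by (rule_tac has_field_derivative_transform_within_open[of _ _ _ "{-1<..<1}"]) auto
  qed
  have "deriv F (1/2) > 0"
    by (rule odd_profile_deriv_pos[OF assms]) simp
  then have "2 * a \<noteq> 0"
    using lin[of "1/2"] by auto
  with lin show ?thesis
    using that by blast
qed

context
  fixes m :: nat and F :: "real \<Rightarrow> real" and \<epsilon> :: real
  assumes \<epsilon>: "\<epsilon> > 0" and m: "m \<ge> 1" and profile: "desing_profile m F"
begin

lemma smooth_on_profile: "smooth_on UNIV F"
  using profile by (auto simp: desing_profile_def even_profile_def odd_profile_def)

lemma deriv_f_eps: "deriv (f_eps m F \<epsilon>) = (\<lambda>x. deriv F (x / \<epsilon>) / \<epsilon> ^ m)"
proof
  fix x
  have "((\<lambda>x. F (x / \<epsilon>)) has_real_derivative deriv F (x / \<epsilon>) * (1 / \<epsilon>)) (at x)"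
    by (rule DERIV_chain2[OF smooth_on_deriv[OF smooth_on_profile]])
      (use \<epsilon> in \<open>auto intro!: derivative_eq_intros\<close>)
  from DERIV_cdivide[OF this, of "\<epsilon> ^ (m - 1)"]
  have "(f_eps m F \<epsilon> has_real_derivative deriv F (x / \<epsilon>) * (1 / \<epsilon>) / \<epsilon> ^ (m - 1)) (at x)"
    by (simp add: f_eps_def[abs_def])
  \<comment> \<open>The exponent \<open>m - 1\<close> is a truncated subtraction, so
    \<open>m \<ge> 1\<close> enters here. The missing factor comes from the inner derivative of x /
    \<epsilon>.\<close>
  moreover have "\<epsilon> * \<epsilon> ^ (m - 1) = \<epsilon> ^ m"
    using m by (simp flip: power_Suc)
  ultimately show "deriv (f_eps m F \<epsilon>) x = deriv F (x / \<epsilon>) / \<epsilon> ^ m"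
    using DERIV_imp_deriv by fastforce
qed

lemma smooth_on_deriv_f_eps: "smooth_on UNIV (deriv (f_eps m F \<epsilon>))"
proof -
  have "smooth_on UNIV (\<lambda>x. x / \<epsilon>)"
    by (intro smooth_on_bounded_linear bounded_linear_divide) simp
  then have "smooth_on UNIV (\<lambda>x. deriv F (x / \<epsilon>) * (1 / \<epsilon> ^ m))"
    by (intro smooth_on_mult smooth_on_const 
        smooth_on_compose[OF smooth_on_deriv_smooth[OF open_UNIV smooth_on_profile]]) auto
  then show ?thesis
    by (simp add: deriv_f_eps)
qed

text \<open>For m even both factors are positive; for m odd both have the sign of x.\<close>

lemma deriv_f_eps_power_pos:
  assumes "x \<noteq> 0"
  shows "deriv (f_eps m F \<epsilon>) x * x ^ m > 0"
proof -
  have "deriv F y * x ^ m > 0" if "y = x / \<epsilon>" for y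
  proof (cases "even m")
    case True
    then have "deriv F y > 0"
      using profile even_profile_deriv_pos by (auto simp: desing_profile_def)
    then show ?thesis
      using True assms by (simp add: zero_less_power_eq)
  next
    case False
    then obtain k where k: "odd_profile k F"
      using profile by (auto simp: desing_profile_def)
    show ?thesis
    proof (cases "x > 0")
      case True
      then show ?thesis
        using odd_profile_deriv_pos(2)[OF k, of y] \<epsilon> that by simp
    next
      case F: False
      then have "y < 0"
        using \<epsilon> that assms by (simp add: divide_less_0_iff)
      moreover have "x ^ m < 0"
        using F False assms by (simp add: power_less_zero_eq)
      ultimately show ?thesis
        using odd_profile_deriv_pos(1)[OF k, of y] by (simp add: mult_neg_neg)
    qed
  qed
  then show ?thesis
    using \<epsilon> by (simp add: deriv_f_eps)
qed

lemma deriv_f_eps_even: "even m \<Longrightarrow> deriv (f_eps m F \<epsilon>) x \<noteq> 0"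
  using profile even_profile_deriv_pos[of _ F "x / \<epsilon>"] \<epsilon>
  by (auto simp: desing_profile_def deriv_f_eps)

lemma deriv_f_eps_odd:
  assumes "odd m"
  obtains d where "d \<noteq> 0" and "deriv (f_eps m F \<epsilon>) 0 = 0"
    and "(deriv (f_eps m F \<epsilon>) has_real_derivative d) (at 0)"
proof -
  obtain k where k: "odd_profile k F"
    using profile assms by (auto simp: desing_profile_def)
  then obtain a where "a \<noteq> 0" and a: "\<And>x. \<bar>x\<bar> < 1 \<Longrightarrow> deriv F x = a * x"
    using odd_profile_deriv_linear by blast
  define d where "d = a / \<epsilon> / \<epsilon> ^ m"
  have eq: "d * x = deriv (f_eps m F \<epsilon>) x" if "x \<in> {-\<epsilon><..<\<epsilon>}" for x
    using a[of "x / \<epsilon>"] that \<epsilon> by (auto simp: deriv_f_eps d_def abs_less_iff field_simps)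
  have "((\<lambda>x. d * x) has_real_derivative d) (at 0)"
    by (auto intro!: derivative_eq_intros)
  then have "(deriv (f_eps m F \<epsilon>) has_real_derivative d) (at 0)"
    by (rule has_field_derivative_transform_within_open[of _ _ _ "{-\<epsilon><..<\<epsilon>}"]) (use eq \<epsilon> in auto)
  then show ?thesis
    using that[of d] eq[of 0] \<open>a \<noteq> 0\<close> \<epsilon> by (simp add: d_def)
qed

end

section \<open>The system in action-angle coordinates\<close>

declare split_paired_All [simp del] split_paired_Ex [simp del]

text \<open>The polynomial P of the overview: the Laurent polynomial with coefficients
  \<open>hat_c\<close> after clearing its pole of order m.\<close>

definition modular_poly :: "nat \<Rightarrow> (nat \<Rightarrow> real) \<Rightarrow> real \<Rightarrow> real" where
  "modular_poly m c x = (\<Sum>i=1..m. hat_c c i * x ^ (m - i))"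

lemma smooth_on_modular_poly: "smooth_on UNIV (modular_poly m c)"
  unfolding modular_poly_def
  by (intro smooth_on_sum smooth_on_mult smooth_on_const smooth_on_power smooth_on_bounded_linear
      bounded_linear_ident open_UNIV)

lemma modular_poly_divide:
  assumes "x \<noteq> 0"
  shows "modular_poly m c x / x ^ m = (\<Sum>i=1..m. hat_c c i / x ^ i)"
  unfolding modular_poly_def sum_divide_distrib
  using assms by (intro sum.cong) (auto simp: power_diff field_simps)

lemma action_angle_form_eq_split_form:
  assumes "act r p \<noteq> 0"
  shows "action_angle_form r m K c p = split_form r (K * modular_poly m c (act r p) / act r p ^ m)"
proof -
  have "(\<Sum>i=1..m. K * hat_c c i / act r p ^ i) = K * (modular_poly m c (act r p) / act r p ^ m)"
    unfolding modular_poly_divide[OF assms] by (simp add: sum_distrib_left)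
  then show ?thesis
    by (intro ext) (simp add: action_angle_form_def split_form_def laurent_beta_def)
qed

text \<open>Explains \<open>hat_c\<close>: differentiating c_(i-1) / x^(i-1) gives -(i-1) c_(i-1) /
  x^i, and the logarithm supplies the term of order 1. So df_r has, up to the factor K, the same
  coefficient as \<open>\<omega>\<close>.\<close>

lemma DERIV_log_laurent:
  assumes "x \<noteq> 0" and "m \<ge> 1"
  shows "((\<lambda>x. c 0 * ln \<bar>x\<bar> + (\<Sum>i=1..m-1. c i * (1 / x ^ i))) has_real_derivative
    modular_poly m c x / x ^ m) (at x)"
proof -
  have ln: "((\<lambda>x. ln \<bar>x\<bar>) has_real_derivative 1 / x) (at x)"
  proof (cases "x > 0")
    case True
    have "(ln has_real_derivative 1 / x) (at x)"
      using True by (auto intro!: derivative_eq_intros)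
    then show ?thesis
      by (rule has_field_derivative_transform_within_open[of _ _ _ "{0<..}"]) (use True in auto)
  next
    case False
    have "((\<lambda>x. ln (- x)) has_real_derivative 1 / x) (at x)"
      using False assms by (auto intro!: derivative_eq_intros simp: field_simps)
    then show ?thesis
      by (rule has_field_derivative_transform_within_open[of _ _ _ "{..<0}"])
        (use False assms in auto)
  qed
  have pow: "((\<lambda>x. c i * (1 / x ^ i)) has_real_derivative - real i * c i / x ^ Suc i) (at x)" for i
  proof (cases i)
    case (Suc n)
    have "((\<lambda>x. c i * (1 / x ^ Suc n)) has_real_derivative
        c i * (- (real (Suc n) * x ^ n) / (x ^ Suc n)\<^sup>2)) (at x)"
      using assms(1) by (auto intro!: derivative_eq_intros simp del: power_Suc simp: power2_eq_square)
    also have "c i * (- (real (Suc n) * x ^ n) / (x ^ Suc n)\<^sup>2) = - real i * c i / x ^ Suc i"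
      using assms(1) by (simp add: Suc power2_eq_square field_simps)
    finally show ?thesis
      by (simp only: Suc)
  qed auto
  have "((\<lambda>x. c 0 * ln \<bar>x\<bar> + (\<Sum>i=1..m-1. c i * (1 / x ^ i))) has_real_derivative
      c 0 * (1 / x) + (\<Sum>i=1..m-1. - real i * c i / x ^ Suc i)) (at x)"
    by (intro DERIV_add DERIV_cmult ln DERIV_sum pow)
  also have "(\<Sum>i=1..m-1. - real i * c i / x ^ Suc i) = (\<Sum>i=Suc 1..m. hat_c c i / x ^ i)"
    using assms(2)
    by (intro sum.reindex_bij_witness[where i = "\<lambda>i. i - 1" and j = Suc]) (auto simp: hat_c_def)
  also have "c 0 * (1 / x) + (\<Sum>i=Suc 1..m. hat_c c i / x ^ i) = modular_poly m c x / x ^ m"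
    unfolding modular_poly_divide[OF assms(1)] using assms(2)
    by (subst (2) sum.atLeast_Suc_atMost) (auto simp: hat_c_def)
  finally show ?thesis .
qed

locale bm_action_angle_system =
  fixes A :: "(real ^ 'n::finite) set" and r :: 'n and m :: nat and K :: real
    and c :: "nat \<Rightarrow> real" and f :: "'n \<Rightarrow> 'n phase \<Rightarrow> real"
  assumes open_A: "open A" and convex_A: "convex A"
    and meets_hypersurface: "(A \<times> UNIV) \<inter> hypersurface r \<noteq> {}" and m_ge_1: "m \<ge> 1"
    and bm_system: "bm_integrable_system r m (A \<times> UNIV) (action_angle_form r m K c) f"
    and f_r: "\<And>p. p \<in> A \<times> UNIV - hypersurface r \<Longrightarrow>
      f r p = c 0 * ln \<bar>act r p\<bar> + (\<Sum>i=1..m-1. c i * (1 / act r p ^ i))"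
    and f_smooth: "\<And>j. j \<noteq> r \<Longrightarrow> smooth_on (A \<times> UNIV) (f j) \<and> angle_periodic_on (A \<times> UNIV) (f j)"
begin

definition M :: "'n phase set" where "M = A \<times> UNIV"

abbreviation \<omega> :: "'n two_form" where "\<omega> \<equiv> action_angle_form r m K c"

abbreviation Q :: "real \<Rightarrow> real" where "Q \<equiv> modular_poly m c"

lemma open_M: "open M"
  unfolding M_def using open_A by (intro open_Times) auto

lemma angle_shift_in_M [simp]: "p + t *\<^sub>R frame (Inr a) \<in> M \<longleftrightarrow> p \<in> M"
  by (cases p) (simp add: M_def frame_def)

lemma smooth_f: "j \<noteq> r \<Longrightarrow> smooth_on M (f j)"
  unfolding M_def using f_smooth by blast

text \<open>Off Z the matrix of \<open>\<omega>\<close> in the b^m-frame has weight K P(x), the pole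
  being absorbed by \<open>anchor\<close>; by continuity this also holds on Z. A zero of the weight
  would put the direction \<phi>_r into the kernel of a nondegenerate form.\<close>

lemma Q_nonzero:
  assumes "p \<in> M"
  shows "K * Q (act r p) \<noteq> 0"
proof
  assume zero: "K * Q (act r p) = 0"
  obtain \<omega>b where b: "two_form_on M \<omega>b" "nondegenerate_on M \<omega>b"
    and \<omega>b: "\<And>p u v. p \<in> M - hypersurface r \<Longrightarrow> \<omega> p (anchor r m p u) (anchor r m p v) = \<omega>b p u v"
    using bm_system unfolding bm_integrable_system_def bm_symplectic_on_def M_def by blast
  have off: "\<omega>b p u v = split_form r (K * Q (act r p)) u v" if "p \<in> M - hypersurface r" for p u v
    using that by (auto simp: \<omega>b[symmetric] action_angle_form_eq_split_form hypersurface_def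
        split_form_def wedge_def laurent_beta_def algebra_simps diff_divide_distrib)
  have "\<omega>b p u v = split_form r (K * Q (act r p)) u v" for u v
  proof (rule eq_off_hypersurface[OF open_M _ _ off \<open>p \<in> M\<close>])
    show "continuous_on M (\<lambda>p. \<omega>b p u v)"
      using b(1) by (simp add: two_form_on_def smooth_on_imp_continuous_on)
    have "continuous_on M (\<lambda>p. Q (act r p))"
      by (intro smooth_on_imp_continuous_on smooth_on_compose_act smooth_on_modular_poly open_M)
    then show "continuous_on M (\<lambda>p. split_form r (K * Q (act r p)) u v)"
      unfolding split_form_def by (intro continuous_intros)
  qed
  then have "\<omega>b p (frame (Inr r)) v = 0" for v
    by (simp add: zero split_form_def wedge_def laurent_beta_def)
  then have "frame (Inr r) = (0 :: 'n phase)"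
    using b(2) \<open>p \<in> M\<close> by (auto simp: nondegenerate_on_def)
  then have "ang r (frame (Inr r) :: 'n phase) = 0"
    by simp
  then show False
    by simp
qed

lemma K_nonzero: "K \<noteq> 0"
  using Q_nonzero meets_hypersurface unfolding M_def by auto

lemma differential_f_r:
  assumes "p \<in> M - hypersurface r"
  shows "differential (f r) p = (\<lambda>v. Q (act r p) / act r p ^ m * act r v)"
proof (rule differential_eqI)
  let ?g = "\<lambda>x. c 0 * ln \<bar>x\<bar> + (\<Sum>i=1..m-1. c i * (1 / x ^ i))"
  have "act r p \<noteq> 0"
    using assms by (simp add: hypersurface_def)
  then have "(?g has_derivative (*) (Q (act r p) / act r p ^ m)) (at (act r p))"
    using DERIV_log_laurent[OF _ m_ge_1] by (simp add: has_field_derivative_def)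
  from has_derivative_compose[OF bounded_linear_imp_has_derivative[OF bounded_linear_act] this]
  have "((\<lambda>p. ?g (act r p)) has_derivative (\<lambda>v. Q (act r p) / act r p ^ m * act r v)) (at p)" .
  then show "(f r has_derivative (\<lambda>v. Q (act r p) / act r p ^ m * act r v)) (at p)"
    by (rule has_derivative_transform_within_open[OF _ open_minus_hypersurface[OF open_M] assms])
      (use f_r in \<open>auto simp: M_def\<close>)
qed

text \<open>The factor P(x) / x^m appears both in df_r and in the weight of \<open>\<omega>\<close>,
  and cancels to the constant 1 / K.\<close>

lemma bm_vf_r:
  assumes "bm_hamiltonian_vf r m M \<omega> (f r) X" and "p \<in> M - hypersurface r"
  shows "X p = (1 / K) *\<^sub>R frame (Inr r)"
proof -
  have x: "act r p \<noteq> 0" and "p \<in> M"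
    using assms(2) by (auto simp: hypersurface_def)
  have "split_form r (K * Q (act r p) / act r p ^ m) (X p) v = - differential (f r) p v" for v
    using assms unfolding bm_hamiltonian_vf_def action_angle_form_eq_split_form[OF x, symmetric]
    by blast
  moreover have "linear (differential (f r) p)"
    unfolding differential_f_r[OF assms(2)]
    by (rule linearI) (simp_all add: add_divide_distrib algebra_simps)
  ultimately have "X p = ham_vec r (differential (f r) p (frame (Inl r)) / (K * Q (act r p) / act r p ^ m))
      (differential (f r) p)"
    using x Q_nonzero[OF \<open>p \<in> M\<close>]
    by (intro split_form_eq_ham_vec)
      (simp_all add: differential_f_r[OF assms(2)])
  then show ?thesis
    using x Q_nonzero[OF \<open>p \<in> M\<close>]
    by (intro phase_eqI) (auto simp: differential_f_r[OF assms(2)])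
qed

lemma bm_commuting:
  obtains X where "\<And>j. bm_hamiltonian_vf r m M \<omega> (f j) (X j)"
    and "\<And>i j p. p \<in> M - hypersurface r \<Longrightarrow> \<omega> p (X i p) (X j p) = 0"
proof -
  have "bm_commuting_on r m M \<omega> f"
    using bm_system unfolding bm_integrable_system_def M_def by blast
  then obtain X where "\<forall>j. bm_hamiltonian_vf r m M \<omega> (f j) (X j)"
    and "\<forall>i j. \<forall>p\<in>M - hypersurface r. \<omega> p (X i p) (X j p) = 0"
    unfolding bm_commuting_on_def by blast
  then show ?thesis
    by (intro that[of X]) blast+
qed

text \<open>\<open>X\<^sub>f\<^sub>r\<close> is the constant multiple \<open>1/K\<close> of \<open>\<partial>\<phi>\<^sub>r\<close>, so commuting with \<open>f r\<close> means not depending on \<open>\<phi>\<^sub>r\<close>.\<close>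

lemma differential_f_angle:
  assumes "j \<noteq> r" and "p \<in> M"
  shows "differential (f j) p (frame (Inr r)) = 0"
proof (rule eq_off_hypersurface[OF open_M continuous_on_differential continuous_on_const _ \<open>p \<in> M\<close>])
  show "smooth_on M (f j)"
    by (rule smooth_f[OF assms(1)])
  fix p assume p: "p \<in> M - hypersurface r"
  obtain X where X: "\<And>j. bm_hamiltonian_vf r m M \<omega> (f j) (X j)"
    "\<And>i j p. p \<in> M - hypersurface r \<Longrightarrow> \<omega> p (X i p) (X j p) = 0"
    using bm_commuting by blast
  have "0 = \<omega> p (X j p) (X r p)"
    using X(2)[OF p] by simp
  also have "\<dots> = - differential (f j) p (X r p)"
    using X(1)[of j] p by (simp add: bm_hamiltonian_vf_def)
  also have "\<dots> = - (1 / K) * differential (f j) p (frame (Inr r))"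
    using linear_cmul[OF linear_differential[OF smooth_f[OF assms(1)]]] p
    by (simp add: bm_vf_r[OF X(1) p])
  finally show "differential (f j) p (frame (Inr r)) = 0"
    using K_nonzero by simp
qed

lemma bm_vf_off_hypersurface:
  assumes "j \<noteq> r" and "bm_hamiltonian_vf r m M \<omega> (f j) X" and "p \<in> M - hypersurface r"
  shows "X p = ham_vec r (act r p ^ m / (K * Q (act r p)) * differential (f j) p (frame (Inl r)))
    (differential (f j) p)"
proof -
  have x: "act r p \<noteq> 0" and "p \<in> M"
    using assms(3) by (auto simp: hypersurface_def)
  have "split_form r (K * Q (act r p) / act r p ^ m) (X p) v = - differential (f j) p v" for v
    using assms unfolding bm_hamiltonian_vf_def action_angle_form_eq_split_form[OF x, symmetric]
    by blast
  then have "X p = ham_vec r (differential (f j) p (frame (Inl r)) / (K * Q (act r p) / act r p ^ m))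
      (differential (f j) p)"
    using x Q_nonzero[OF \<open>p \<in> M\<close>] assms \<open>p \<in> M\<close>
    by (intro split_form_eq_ham_vec linear_differential[OF smooth_f] differential_f_angle) auto
  then show ?thesis
    by (simp add: mult.commute)
qed

text \<open>On Z a b^m-Hamiltonian field is not determined by an equation with
  \<open>\<omega>\<close>; it is pinned down there as the continuous extension, which exists because
  the field is \<open>anchor\<close> applied to a smooth field.\<close>

lemma continuous_on_bm_vf:
  assumes "bm_hamiltonian_vf r m M \<omega> h X"
  shows "continuous_on M (\<lambda>p. act a (X p))" and "continuous_on M (\<lambda>p. ang a (X p))"
proof -
  obtain Y where Y: "vector_field_on M Y" and X: "\<And>p. p \<in> M \<Longrightarrow> X p = anchor r m p (Y p)"
    using assms by (auto simp: bm_hamiltonian_vf_def)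
  have "continuous_on M Y"
    using Y by (simp add: vector_field_on_def smooth_on_imp_continuous_on)
  then have "continuous_on M (\<lambda>p. act a (anchor r m p (Y p)))"
    "continuous_on M (\<lambda>p. ang a (anchor r m p (Y p)))"
    by (cases "a = r"; simp; intro continuous_intros; simp)+
  then show "continuous_on M (\<lambda>p. act a (X p))" and "continuous_on M (\<lambda>p. ang a (X p))"
    using X continuous_on_cong[of M M "\<lambda>p. act a (X p)" "\<lambda>p. act a (anchor r m p (Y p))"]
      continuous_on_cong[of M M "\<lambda>p. ang a (X p)" "\<lambda>p. ang a (anchor r m p (Y p))"] by simp_all
qed

lemma bm_vf_r_eq:
  assumes X: "bm_hamiltonian_vf r m M \<omega> (f r) X" and "p \<in> M"
  shows "X p = (1 / K) *\<^sub>R frame (Inr r)"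
proof (rule phase_eqI)
  fix a
  show "act a (X p) = act a ((1 / K) *\<^sub>R frame (Inr r))"
    by (rule eq_off_hypersurface[where r = r, OF open_M continuous_on_bm_vf(1)[OF X] continuous_on_const _ \<open>p \<in> M\<close>])
      (simp add: bm_vf_r[OF X])
  show "ang a (X p) = ang a ((1 / K) *\<^sub>R frame (Inr r))"
    by (rule eq_off_hypersurface[where r = r, OF open_M continuous_on_bm_vf(2)[OF X] continuous_on_const _ \<open>p \<in> M\<close>])
      (simp add: bm_vf_r[OF X])
qed

lemma smooth_on_ratio: "smooth_on M (\<lambda>p. act r p ^ m / (K * Q (act r p)))"
  by (intro smooth_on_divide smooth_on_power smooth_on_mult smooth_on_const smooth_on_act
      smooth_on_compose_act smooth_on_modular_poly open_M Q_nonzero)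

text \<open>The inverse weight x^m / (K P(x)) is smooth across Z, so the formula obtained by
  division off Z has a continuous extension to Z.\<close>

lemma bm_vf_eq:
  assumes "j \<noteq> r" and X: "bm_hamiltonian_vf r m M \<omega> (f j) X" and "p \<in> M"
  shows "X p = ham_vec r (act r p ^ m / (K * Q (act r p)) * differential (f j) p (frame (Inl r)))
    (differential (f j) p)"
proof -
  let ?H = "\<lambda>p. ham_vec r (act r p ^ m / (K * Q (act r p)) * differential (f j) p (frame (Inl r)))
    (differential (f j) p)"
  have d: "continuous_on M (\<lambda>p. differential (f j) p v)" for v
    by (rule continuous_on_differential[OF smooth_f[OF assms(1)]])
  have H: "continuous_on M (\<lambda>p. act a (?H p))" "continuous_on M (\<lambda>p. ang a (?H p))" for a
    unfolding act_ham_vec ang_ham_vec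
    by (cases "a = r"; simp only: if_True if_False refl simp_thms; intro continuous_on_minus
        continuous_on_mult continuous_on_const d smooth_on_imp_continuous_on[OF smooth_on_ratio])+
  show ?thesis
  proof (rule phase_eqI)
    fix a
    show "act a (X p) = act a (?H p)"
      by (rule eq_off_hypersurface[where r = r, OF open_M continuous_on_bm_vf(1)[OF X] H(1) _ \<open>p \<in> M\<close>])
        (simp only: bm_vf_off_hypersurface[OF assms(1,2)])
    show "ang a (X p) = ang a (?H p)"
      by (rule eq_off_hypersurface[where r = r, OF open_M continuous_on_bm_vf(2)[OF X] H(2) _ \<open>p \<in> M\<close>])
        (simp only: bm_vf_off_hypersurface[OF assms(1,2)])
  qed
qed

text \<open>Off Z this is commutation with respect to \<open>\<omega>\<close>, freed of the singular
  weight; continuity gives it on Z.\<close>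

lemma reduced_bracket_f:
  assumes "i \<noteq> r" and "j \<noteq> r" and "p \<in> M"
  shows "reduced_bracket r (differential (f i) p) (differential (f j) p) = 0"
proof (rule eq_off_hypersurface[OF open_M _ continuous_on_const _ \<open>p \<in> M\<close>])
  show "continuous_on M (\<lambda>p. reduced_bracket r (differential (f i) p) (differential (f j) p))"
    unfolding reduced_bracket_def
    by (intro continuous_intros continuous_on_differential smooth_f assms)
  fix p assume p: "p \<in> M - hypersurface r"
  then have x: "act r p \<noteq> 0"
    by (auto simp: hypersurface_def)
  obtain X where X: "\<And>j. bm_hamiltonian_vf r m M \<omega> (f j) (X j)"
    "\<And>i j p. p \<in> M - hypersurface r \<Longrightarrow> \<omega> p (X i p) (X j p) = 0"
    using bm_commuting by blast
  have "0 = \<omega> p (X i p) (X j p)"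
    using X(2)[OF p] by simp
  also have "\<dots> = - reduced_bracket r (differential (f i) p) (differential (f j) p)"
    by (simp only: action_angle_form_eq_split_form[OF x] split_form_ham_vec_ham_vec
        bm_vf_off_hypersurface[OF assms(1) X(1) p] bm_vf_off_hypersurface[OF assms(2) X(1) p])
  finally show "reduced_bracket r (differential (f i) p) (differential (f j) p) = 0"
    by simp
qed

text \<open>Independence of the df_j with j \<noteq> r on the directions I_b, \<phi>_b with b
  \<noteq> r. Since df_r is a multiple of dI_r and all df_j annihilate the direction \<phi>_r, this
  is the part of independence that neither the pole nor the profile affects.\<close>

definition reduced_independent :: "'n phase \<Rightarrow> bool" where
  "reduced_independent p \<longleftrightarrow> (\<forall>a. (\<forall>b. b \<noteq> r \<longrightarrow>
     (\<Sum>j\<in>UNIV - {r}. a j * differential (f j) p (frame (Inl b))) = 0 \<and>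
     (\<Sum>j\<in>UNIV - {r}. a j * differential (f j) p (frame (Inr b))) = 0) \<longrightarrow> (\<forall>j. j \<noteq> r \<longrightarrow> a j = 0))"

lemma sum_split_r: "(\<Sum>j\<in>UNIV. g j) = g r + (\<Sum>j\<in>UNIV - {r}. g j :: real)"
  by (rule sum.remove) auto

lemma reduced_independent_if_independent:
  assumes "p \<in> M" and "independent_covectors L" and "\<And>j. linear (L j)"
    and Lr: "\<And>v. L r v = Q (act r p) * act r v"
    and L: "\<And>j v. j \<noteq> r \<Longrightarrow> L j v = differential (f j) p (anchor r m p v)"
  shows "reduced_independent p"
  unfolding reduced_independent_def
proof (intro allI impI)
  fix a j
  assume a: "\<forall>b. b \<noteq> r \<longrightarrow>
     (\<Sum>j\<in>UNIV - {r}. a j * differential (f j) p (frame (Inl b))) = 0 \<and>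
     (\<Sum>j\<in>UNIV - {r}. a j * differential (f j) p (frame (Inr b))) = 0" and "j \<noteq> r"
  \<comment> \<open>The coefficient at \<open>r\<close> is chosen to cancel the component along I_r,
    which is possible because P(x) \<noteq> 0. The combination then vanishes on the whole
    frame.\<close>
  define a' where "a' = a(r := - (\<Sum>j\<in>UNIV - {r}. a j * L j (frame (Inl r))) / Q (act r p))"
  define L' where "L' v = (\<Sum>j\<in>UNIV. a' j * L j v)" for v
  have anchor: "anchor r m p (frame (Inl b)) = frame (Inl b)" if "b \<noteq> r" for b
    by (rule phase_eqI) (use that in auto)
  have anchor': "anchor r m p (frame (Inr b)) = frame (Inr b)" for b
    by (rule phase_eqI) auto
  have L'_eq: "L' v = a' r * (Q (act r p) * act r v) + (\<Sum>j\<in>UNIV - {r}. a j * L j v)" for v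
    unfolding L'_def sum_split_r Lr by (simp add: a'_def)
  have "L' (frame (Inl b)) = 0" for b
  proof (cases "b = r")
    case True
    then show ?thesis
      using Q_nonzero[OF \<open>p \<in> M\<close>] by (simp add: L'_eq a'_def)
  next
    case False
    then show ?thesis
      using a by (simp add: L'_eq L anchor)
  qed
  moreover have "L' (frame (Inr b)) = 0" for b
    using a differential_f_angle[OF _ \<open>p \<in> M\<close>]
    by (cases "b = r") (simp_all add: L'_eq L anchor')
  moreover have "linear L'"
    unfolding L'_def
    by (intro linear_compose_sum ballI linearI)
      (simp_all add: linear_add[OF assms(3)] linear_cmul[OF assms(3)] algebra_simps)
  ultimately have "L' v = 0" for v
    using linear_phase_expansion[of L' v] by simp
  then have "a' j = 0"
    using assms(2) by (simp add: independent_covectors_def L'_def)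
  then show "a j = 0"
    using \<open>j \<noteq> r\<close> by (simp add: a'_def)
qed

text \<open>The b^m-differentials are linked to the functions off Z only. Both formulas for them
  extend continuously, so the assumed independence at every point of Z can be used as well.\<close>

lemma reduced_independent_dense:
  "\<exists>D\<subseteq>M. M \<subseteq> closure D \<and> (\<forall>p\<in>D \<union> (M \<inter> hypersurface r). reduced_independent p)"
proof -
  obtain \<delta> D where \<delta>: "\<And>j. bm_differential r m M (f j) (\<delta> j)"
    and D: "D \<subseteq> M" "M \<subseteq> closure D"
    and ind: "\<And>p. p \<in> D \<union> (M \<inter> hypersurface r) \<Longrightarrow> independent_covectors (\<lambda>j. \<delta> j p)"
    using bm_system unfolding bm_integrable_system_def M_def by blast
  have cont: "continuous_on M (\<lambda>p. \<delta> j p v)" for j v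
    using \<delta>[of j] by (simp add: bm_differential_def smooth_on_imp_continuous_on)
  have "reduced_independent p" if p: "p \<in> D \<union> (M \<inter> hypersurface r)" for p
  proof (rule reduced_independent_if_independent[OF _ ind[OF p]])
    show "p \<in> M"
      using p D by auto
    show "linear (\<delta> j p)" for j
      using \<delta>[of j] \<open>p \<in> M\<close> by (simp add: bm_differential_def)
    have "continuous_on M (\<lambda>p. Q (act r p) * act r v)" for v
      by (intro continuous_intros smooth_on_imp_continuous_on smooth_on_compose_act
          smooth_on_modular_poly open_M)
    then show "\<delta> r p v = Q (act r p) * act r v" for v
    proof (rule eq_off_hypersurface[OF open_M cont _ _ \<open>p \<in> M\<close>])
      fix p assume "p \<in> M - hypersurface r"
      then show "\<delta> r p v = Q (act r p) * act r v"
        using \<delta>[of r] by (auto simp: bm_differential_def differential_f_r hypersurface_def)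
    qed
    show "\<delta> j p v = differential (f j) p (anchor r m p v)" if "j \<noteq> r" for j v
    proof (rule eq_off_hypersurface[OF open_M cont _ _ \<open>p \<in> M\<close>])
      have "continuous_on M (\<lambda>p. act a (anchor r m p v))" for a
        by (cases "a = r"; simp; intro continuous_intros)
      \<comment> \<open>The vector fed to the differential depends on the point, so continuity is
        read off its expansion in the frame.\<close>
      then have "continuous_on M (\<lambda>p. \<Sum>a\<in>UNIV. act a (anchor r m p v) * differential (f j) p (frame (Inl a))
          + ang a (anchor r m p v) * differential (f j) p (frame (Inr a)))"
        unfolding ang_anchor
        by (intro continuous_on_sum continuous_on_add continuous_on_mult continuous_on_const
            continuous_on_differential smooth_f that)
      then show "continuous_on M (\<lambda>p. differential (f j) p (anchor r m p v))"
        by (rule continuous_on_eq)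
          (rule linear_phase_expansion[OF linear_differential[OF smooth_f[OF that]], symmetric])
      show "\<delta> j p v = differential (f j) p (anchor r m p v)" if "p \<in> M - hypersurface r" for p
        using \<delta>[of j] that by (auto simp: bm_differential_def)
    qed
  qed
  then show ?thesis
    using D by blast
qed

text \<open>The whole line in direction \<phi>_r stays in \<open>M\<close>, because the angles range
  over all of \<open>UNIV\<close>; along it the derivative of \<open>f j\<close> is zero.\<close>

lemma f_angle_invariant:
  assumes "j \<noteq> r" and "p \<in> M"
  shows "f j (p + t *\<^sub>R frame (Inr r)) = f j p"
proof -
  let ?g = "\<lambda>t. f j (p + t *\<^sub>R frame (Inr r))"
  have "(?g has_derivative (\<lambda>h. differential (f j) (p + t *\<^sub>R frame (Inr r)) (h *\<^sub>R frame (Inr r)))) (at t)" for t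
    by (rule has_derivative_compose[OF _ smooth_on_has_differential[OF smooth_f[OF assms(1)]]])
      (auto intro!: derivative_eq_intros simp: assms)
  moreover have "differential (f j) (p + t *\<^sub>R frame (Inr r)) (h *\<^sub>R frame (Inr r)) = 0" for t h
    using linear_cmul[OF linear_differential[OF smooth_f[OF assms(1)]]] differential_f_angle assms by simp
  ultimately have "(?g has_real_derivative 0) (at t)" for t
    by (simp add: has_field_derivative_def lambda_zero)
  then have "?g t = ?g 0"
    using DERIV_isconst_all[of ?g t 0] by blast
  then show ?thesis
    by simp
qed

lemma differential_f_angle_invariant:
  assumes "j \<noteq> r" and "p \<in> M"
  shows "differential (f j) (p + t *\<^sub>R frame (Inr r)) = differential (f j) p"
  by (rule differential_translate[OF open_M _ smooth_f[OF assms(1)] assms(2)])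
    (simp add: f_angle_invariant[OF assms(1)])

end

section \<open>The desingularized system\<close>

lemma ham_vec_cong:
  assumes "\<And>a. a \<noteq> r \<Longrightarrow> L (frame (Inl a)) = L' (frame (Inl a))"
    and "\<And>a. a \<noteq> r \<Longrightarrow> L (frame (Inr a)) = L' (frame (Inr a))"
  shows "ham_vec r s L = ham_vec r s L'"
  using assms by (intro phase_eqI) auto

locale desingularization = bm_action_angle_system A r m K c f
  for A :: "(real ^ 'n::finite) set" and r m K c f +
  fixes F :: "real \<Rightarrow> real" and \<epsilon> :: real
  assumes \<epsilon>_pos: "\<epsilon> > 0" and profile: "desing_profile m F"
begin

section \<open>The reparametrization of the action I_r\<close>

abbreviation \<rho> :: "real \<Rightarrow> real" where "\<rho> \<equiv> deriv (f_eps m F \<epsilon>)"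

lemmas smooth_\<rho> = smooth_on_deriv_f_eps[OF \<epsilon>_pos m_ge_1 profile]
  and \<rho>_power_pos = deriv_f_eps_power_pos[OF \<epsilon>_pos m_ge_1 profile]
  and \<rho>_even = deriv_f_eps_even[OF \<epsilon>_pos m_ge_1 profile]
  and \<rho>_odd = deriv_f_eps_odd[OF \<epsilon>_pos m_ge_1 profile]

lemma \<rho>_nonzero: "x \<noteq> 0 \<Longrightarrow> \<rho> x \<noteq> 0"
  using \<rho>_power_pos[of x] by auto

text \<open>The new action with the common factor K P cancelled from the quotient. This integrand is
  smooth on the whole line, wherever P may vanish.\<close>

definition h :: "real \<Rightarrow> real" where "h x = (LBINT \<tau>=0..x. \<rho> \<tau> * \<tau> ^ m)"

lemma smooth_\<rho>_power: "smooth_on UNIV (\<lambda>x. \<rho> x * x ^ m)"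
  by (intro smooth_on_mult smooth_\<rho> smooth_on_power smooth_on_bounded_linear bounded_linear_ident
      open_UNIV)

lemma smooth_h: "smooth_on UNIV h"
  unfolding h_def[abs_def] by (rule smooth_on_interval_integral[OF smooth_\<rho>_power])

lemma DERIV_h: "(h has_real_derivative \<rho> x * x ^ m) (at x)"
  unfolding h_def[abs_def]
  by (rule DERIV_interval_integral[OF smooth_on_imp_continuous_on[OF smooth_\<rho>_power]])

lemma h_0 [simp]: "h 0 = 0"
  by (simp add: h_def zero_ereal_def)

text \<open>The derivative of \<open>h\<close> vanishes at 0, so an interval containing 0 is split
  there and positivity is applied to the open halves.\<close>

lemma strict_mono_h: "strict_mono h"
proof (rule strict_monoI)
  have *: "h x < h y" if "x < y" and "0 \<notin> {x<..<y}" for x y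
  proof (rule DERIV_pos_imp_increasing_open[OF \<open>x < y\<close>])
    fix z assume "x < z" "z < y"
    then have "z \<noteq> 0"
      using that(2) by auto
    then show "\<exists>d. (h has_real_derivative d) (at z) \<and> 0 < d"
      using DERIV_h \<rho>_power_pos by blast
  next
    show "continuous_on {x..y} h"
      by (intro continuous_at_imp_continuous_on ballI DERIV_isCont[OF DERIV_h])
  qed
  fix x y :: real assume "x < y"
  then show "h x < h y"
    using *[of x y] *[of x 0] *[of 0 y] by (cases "0 \<in> {x<..<y}") auto
qed

text \<open>P is known to be nonzero only at values of x attained on \<open>M\<close>. Convexity of
  \<open>A\<close>, together with a point of Z, makes every value between 0 and x(p) attained, so
  the integral defining the new action meets no zero of P.\<close>

lemma segment_in_M:
  assumes "p \<in> M" and "0 \<le> s" and "s \<le> 1"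
  obtains q where "q \<in> M" and "act r q = s * act r p"
proof -
  obtain q0 where q0: "q0 \<in> M" "act r q0 = 0"
    using meets_hypersurface by (auto simp: M_def hypersurface_def)
  have "fst p \<in> A" "fst q0 \<in> A"
    using assms(1) q0(1) by (auto simp: M_def)
  then have "(1 - s) *\<^sub>R fst q0 + s *\<^sub>R fst p \<in> A"
    using convex_A assms by (auto simp: convex_def)
  then show ?thesis
    using q0(2) by (intro that[of "((1 - s) *\<^sub>R fst q0 + s *\<^sub>R fst p, 0)"]) (auto simp: M_def act_def)
qed

lemma desing_ratio_eq:
  assumes "q \<in> M"
  shows "desing_ratio m K c F \<epsilon> (act r q) = \<rho> (act r q) * act r q ^ m"
proof (cases "act r q = 0")
  case True
  then show ?thesis
    \<comment> \<open>At 0 every summand of the denominator is a division by 0, so the quotient is 0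
      by convention, in agreement with 0^m = 0 for m \<ge> 1.\<close>
    using m_ge_1 by (simp add: desing_ratio_def power_0_left sum.neutral)
next
  case False
  have "(\<Sum>i=1..m. K * hat_c c i * F_eps m F \<epsilon> i (act r q)) = \<rho> (act r q) * (K * Q (act r q))"
    by (simp add: F_eps_def modular_poly_def sum_distrib_left mult_ac)
  moreover have "(\<Sum>j=1..m. K * hat_c c j / act r q ^ j) = K * (Q (act r q) / act r q ^ m)"
    unfolding modular_poly_divide[OF False] by (simp add: sum_distrib_left)
  ultimately show ?thesis
    using Q_nonzero[OF assms] False by (simp add: desing_ratio_def)
qed

lemma integral_desing_ratio:
  assumes "p \<in> M"
  shows "(LBINT \<tau>=0..act r p. desing_ratio m K c F \<epsilon> \<tau>) = h (act r p)"
  unfolding h_def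
proof (rule interval_integral_cong)
  fix \<tau> assume "\<tau> \<in> einterval (min 0 (ereal (act r p))) (max 0 (ereal (act r p)))"
  then have \<tau>: "0 < \<tau> \<and> \<tau> < act r p \<or> act r p < \<tau> \<and> \<tau> < 0"
    by (auto simp: einterval_iff min_def max_def zero_ereal_def split: if_splits)
  then have "0 \<le> \<tau> / act r p" "\<tau> / act r p \<le> 1" "\<tau> = \<tau> / act r p * act r p"
    by (auto simp: divide_simps)
  then obtain q where "q \<in> M" "act r q = \<tau>"
    using segment_in_M[OF assms, of "\<tau> / act r p"] by auto
  then show "desing_ratio m K c F \<epsilon> \<tau> = \<rho> \<tau> * \<tau> ^ m"
    using desing_ratio_eq by blast
qed

text \<open>
  The new coordinates with the angle \<open>\<phi>\<^sub>r\<close> left unscaled. Since \<open>f j\<close> does not depend on \<open>\<phi>\<^sub>r\<close>, this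
  map can replace the desingularizing coordinates; unlike them it is injective.
\<close>

definition \<Psi> :: "'n phase \<Rightarrow> 'n phase" where
  "\<Psi> p = p + (h (act r p) - act r p) *\<^sub>R frame (Inl r)"

lemma act_\<Psi> [simp]: "act a (\<Psi> p) = (if a = r then h (act r p) else act a p)"
  and ang_\<Psi> [simp]: "ang a (\<Psi> p) = ang a p"
  by (auto simp: \<Psi>_def)

lemma \<Psi>_shift: "\<Psi> (p + t *\<^sub>R frame (Inr a)) = \<Psi> p + t *\<^sub>R frame (Inr a)"
  by (simp add: \<Psi>_def)

lemma \<Psi>_on_hypersurface: "p \<in> hypersurface r \<Longrightarrow> \<Psi> p = p"
  by (simp add: \<Psi>_def hypersurface_def)

lemma inj_\<Psi>: "inj \<Psi>"
proof (rule injI)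
  fix p q assume eq: "\<Psi> p = \<Psi> q"
  show "p = q"
  proof (rule phase_eqI)
    fix a
    show "act a p = act a q"
      using arg_cong[OF eq, of "act a"] strict_mono_eq[OF strict_mono_h]
      by (cases "a = r") auto
    show "ang a p = ang a q"
      using arg_cong[OF eq, of "ang a"] by simp
  qed
qed

lemma smooth_\<Psi>: "open S \<Longrightarrow> smooth_on S \<Psi>"
  unfolding \<Psi>_def[abs_def]
  by (intro smooth_on_add smooth_on_scaleR smooth_on_diff smooth_on_const smooth_on_act
      smooth_on_compose_act[OF smooth_h] smooth_on_bounded_linear[OF _ bounded_linear_ident])

lemma has_derivative_compose_act:
  assumes "(g has_real_derivative D) (at (act a p))"
  shows "((\<lambda>p. g (act a p)) has_derivative (\<lambda>v. D * act a v)) (at p)"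
  using has_derivative_compose[OF bounded_linear_imp_has_derivative[OF bounded_linear_act]
      assms[unfolded has_field_derivative_def]] .

lemma has_derivative_\<Psi>:
  "(\<Psi> has_derivative (\<lambda>v. v + ((\<rho> (act r p) * act r p ^ m - 1) * act r v) *\<^sub>R frame (Inl r))) (at p)"
proof -
  have "(\<Psi> has_derivative
      (\<lambda>v. v + (\<rho> (act r p) * act r p ^ m * act r v - act r v) *\<^sub>R frame (Inl r))) (at p)"
    unfolding \<Psi>_def[abs_def]
    by (intro has_derivative_add has_derivative_ident has_derivative_scaleR_left has_derivative_diff
        has_derivative_compose_act[OF DERIV_h] bounded_linear_imp_has_derivative bounded_linear_act)
  then show ?thesis
    by (simp add: left_diff_distrib)
qed

section \<open>The domain of the desingularized system\<close>

definition U :: "'n phase set" where "U = desing_domain r m K c F \<epsilon> M"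

abbreviation f\<epsilon> :: "'n \<Rightarrow> 'n phase \<Rightarrow> real" where "f\<epsilon> \<equiv> desing_map r m K c F \<epsilon> f"

abbreviation \<omega>\<epsilon> :: "'n two_form" where "\<omega>\<epsilon> \<equiv> desing_form r m K c F \<epsilon>"

lemma desing_coord_eq:
  assumes "p \<in> M"
  shows "desing_coord r m K c F \<epsilon> p =
    \<Psi> p + ((\<rho> (act r p) * act r p ^ m - 1) * ang r p) *\<^sub>R frame (Inr r)"
  by (rule phase_eqI)
    (auto simp: desing_coord_def act_def[of _ "(_, _)"] ang_def[of _ "(_, _)"]
      desing_ratio_eq[OF assms] integral_desing_ratio[OF assms] algebra_simps)

text \<open>\<open>desing_coord\<close> and \<open>\<Psi>\<close> differ by a shift of \<phi>_r,
  under which \<open>M\<close> is invariant.\<close>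

lemma U_eq: "U = {p \<in> M. \<Psi> p \<in> M}"
  by (auto simp: U_def desing_domain_def desing_coord_eq)

lemma U_subset_M: "U \<subseteq> M"
  by (auto simp: U_eq)

lemma \<Psi>_in_M: "p \<in> U \<Longrightarrow> \<Psi> p \<in> M"
  by (auto simp: U_eq)

lemma open_U: "open U"
proof -
  have "open (M \<inter> \<Psi> -` M)"
    by (rule continuous_open_preimage[OF smooth_on_imp_continuous_on[OF smooth_\<Psi>[OF open_M]] open_M open_M])
  then show ?thesis
    by (simp add: U_eq Int_def)
qed

text \<open>\<open>\<Psi>\<close> fixes Z since h(0) = 0. As \<open>U\<close> is open, it is a
  neighbourhood of Z in \<open>M\<close>.\<close>

lemma hypersurface_in_U: "M \<inter> hypersurface r \<subseteq> U"
  by (auto simp: U_eq \<Psi>_on_hypersurface)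

lemma angle_shift_in_U [simp]: "p + t *\<^sub>R frame (Inr a) \<in> U \<longleftrightarrow> p \<in> U"
  by (simp add: U_eq \<Psi>_shift)

lemma phase_domain_U: "phase_domain U"
  unfolding phase_domain_def
proof (intro exI conjI)
  show "open (fst ` U)"
    by (rule open_image_fst[OF open_U])
  show "fst ` U \<noteq> {}"
    using hypersurface_in_U meets_hypersurface by (auto simp: M_def)
  have "\<Psi> (I, \<phi>) \<in> M \<longleftrightarrow> \<Psi> (I, \<phi>') \<in> M" and "(I, \<phi>) \<in> M \<longleftrightarrow> (I, \<phi>') \<in> M" for I \<phi> \<phi>'
    by (simp_all add: \<Psi>_def M_def frame_def act_def)
  then have U: "(I, \<phi>) \<in> U \<longleftrightarrow> (I, \<phi>') \<in> U" for I \<phi> \<phi>'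
    unfolding U_eq by blast
  show "U = fst ` U \<times> UNIV"
  proof (intro set_eqI iffI)
    fix q :: "'n phase" assume "q \<in> fst ` U \<times> UNIV"
    then obtain q' where "q' \<in> U" "fst q = fst q'"
      by (auto simp: mem_Times_iff)
    then show "q \<in> U"
      using U[of "fst q'" "snd q'" "snd q"] by (cases q) simp
  qed (simp add: mem_Times_iff)
qed

section \<open>The desingularized functions and their differentials\<close>

lemma f\<epsilon>_eq: "j \<noteq> r \<Longrightarrow> p \<in> U \<Longrightarrow> f\<epsilon> j p = f j (\<Psi> p)"
  using U_subset_M by (auto simp: desing_map_def desing_coord_eq f_angle_invariant \<Psi>_in_M)

text \<open>Lets the final statement speak of the desingularizing coordinates while the argument
  works with \<open>\<Psi>\<close>.\<close>

lemma differential_f_desing_coord: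
  "j \<noteq> r \<Longrightarrow> p \<in> U \<Longrightarrow>
    differential (f j) (desing_coord r m K c F \<epsilon> p) = differential (f j) (\<Psi> p)"
  using U_subset_M by (auto simp: desing_coord_eq differential_f_angle_invariant \<Psi>_in_M)

lemma smooth_f\<epsilon>: "smooth_on U (f\<epsilon> j)"
proof (cases "j = r")
  case True
  have "smooth_on UNIV (F_eps m F \<epsilon> i)" for i
    unfolding F_eps_def[abs_def]
    by (intro smooth_on_mult smooth_\<rho> smooth_on_power smooth_on_bounded_linear bounded_linear_ident
        open_UNIV)
  then have "smooth_on UNIV (G_eps m F \<epsilon> i)" for i
    unfolding G_eps_def[abs_def] by (rule smooth_on_interval_integral)
  then have "smooth_on U (\<lambda>p. \<Sum>i=1..m. hat_c c i * G_eps m F \<epsilon> i (act r p))"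
    by (intro smooth_on_sum smooth_on_mult smooth_on_const smooth_on_compose_act open_U)
  then show ?thesis
    by (simp add: True desing_map_def[abs_def])
next
  case False
  show ?thesis
    by (rule smooth_on_cong[OF open_U f\<epsilon>_eq[OF False, symmetric]
          smooth_on_compose[OF smooth_f[OF False] smooth_\<Psi>[OF open_U] open_U]])
      (use \<Psi>_in_M in auto)
qed

lemma linear_df\<epsilon>: "p \<in> U \<Longrightarrow> linear (differential (f\<epsilon> j) p)"
  by (rule linear_differential[OF smooth_f\<epsilon>])

text \<open>By the choice of the exponents m - i in \<open>F_eps\<close>, the combination of the
  integrands with coefficients \<open>hat_c\<close> is f_eps' P: the pole factor 1 / x^m in df_r is
  replaced by f_eps'.\<close>

lemma differential_f\<epsilon>_r: "differential (f\<epsilon> r) p = (\<lambda>v. \<rho> (act r p) * Q (act r p) * act r v)"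
proof (rule differential_eqI)
  have "continuous_on UNIV (F_eps m F \<epsilon> i)" for i
    unfolding F_eps_def[abs_def]
    by (intro continuous_intros smooth_on_imp_continuous_on[OF smooth_\<rho>])
  then have "(G_eps m F \<epsilon> i has_real_derivative F_eps m F \<epsilon> i x) (at x)" for i x
    unfolding G_eps_def[abs_def] by (rule DERIV_interval_integral)
  then have "((\<lambda>x. \<Sum>i=1..m. hat_c c i * G_eps m F \<epsilon> i x) has_real_derivative
      (\<Sum>i=1..m. hat_c c i * F_eps m F \<epsilon> i (act r p))) (at (act r p))"
    by (intro DERIV_sum DERIV_cmult)
  also have "(\<Sum>i=1..m. hat_c c i * F_eps m F \<epsilon> i (act r p)) = \<rho> (act r p) * Q (act r p)"
    by (simp add: F_eps_def modular_poly_def sum_distrib_left mult_ac)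
  finally show "(f\<epsilon> r has_derivative (\<lambda>v. \<rho> (act r p) * Q (act r p) * act r v)) (at p)"
    using has_derivative_compose_act by (simp add: desing_map_def[abs_def])
qed

lemma differential_f\<epsilon>:
  assumes "j \<noteq> r" and "p \<in> U"
  shows "differential (f\<epsilon> j) p = (\<lambda>v. differential (f j) (\<Psi> p)
    (v + ((\<rho> (act r p) * act r p ^ m - 1) * act r v) *\<^sub>R frame (Inl r)))"
  by (rule differential_eqI, rule has_derivative_transform_within_open[OF
        has_derivative_compose[OF has_derivative_\<Psi>
          smooth_on_has_differential[OF smooth_f[OF assms(1)] \<Psi>_in_M[OF assms(2)]]] open_U assms(2)])
    (simp add: f\<epsilon>_eq[OF assms(1)])

lemma differential_f\<epsilon>_frame:
  assumes "j \<noteq> r" and "p \<in> U"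
  shows "b \<noteq> r \<Longrightarrow> differential (f\<epsilon> j) p (frame (Inl b)) = differential (f j) (\<Psi> p) (frame (Inl b))"
    and "differential (f\<epsilon> j) p (frame (Inr b)) = differential (f j) (\<Psi> p) (frame (Inr b))"
    and "differential (f\<epsilon> j) p (frame (Inl r)) =
      \<rho> (act r p) * act r p ^ m * differential (f j) (\<Psi> p) (frame (Inl r))"
proof -
  note lin = linear_differential[OF smooth_f[OF assms(1)] \<Psi>_in_M[OF assms(2)]]
  show "differential (f\<epsilon> j) p (frame (Inl r)) =
      \<rho> (act r p) * act r p ^ m * differential (f j) (\<Psi> p) (frame (Inl r))"
    unfolding differential_f\<epsilon>[OF assms] linear_add[OF lin] linear_cmul[OF lin]
    by (simp add: algebra_simps)
qed (auto simp: differential_f\<epsilon>[OF assms])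

lemma differential_f\<epsilon>_angle:
  assumes "p \<in> U"
  shows "differential (f\<epsilon> j) p (frame (Inr r)) = 0"
  using assms differential_f_angle[OF _ \<Psi>_in_M[OF assms]]
  by (cases "j = r") (simp_all add: differential_f\<epsilon>_r differential_f\<epsilon>_frame)

section \<open>Hamiltonian vector fields of the desingularized form\<close>

lemma \<omega>\<epsilon>_eq: "\<omega>\<epsilon> p = split_form r (\<rho> (act r p) * (K * Q (act r p)))"
proof -
  let ?x = "act r p"
  have "(\<Sum>i<m. ?x ^ i * hat_c c (m - i)) = Q ?x"
    unfolding modular_poly_def
    by (rule sum.reindex_bij_witness[where i = "\<lambda>i. m - i" and j = "\<lambda>i. m - i"]) auto
  then have "(\<Sum>i<m. ?x ^ i * laurent_alpha r K c (m - i) w) = K * Q ?x * ang r w" for w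
    by (simp add: laurent_alpha_def sum_distrib_left sum_distrib_right mult_ac flip: \<open>_ = Q ?x\<close>)
  then show ?thesis
    by (intro ext) (simp add: desing_form_def laurent_form_def split_form_def wedge_def algebra_simps)
qed

text \<open>The speed of the Hamiltonian flow of \<open>f\<epsilon> j\<close> in the direction \<open>\<phi>\<^sub>r\<close>; no factor \<open>\<rho>\<close> is left.\<close>

definition speed :: "'n \<Rightarrow> 'n phase \<Rightarrow> real" where
  "speed j p = (if j = r then 1 / K
     else act r p ^ m / (K * Q (act r p)) * differential (f j) (\<Psi> p) (frame (Inl r)))"

text \<open>The equation for the angular velocity is kept multiplied by the weight, so it also holds
  on the fold, where the weight is 0.\<close>

lemma speed_eq:
  assumes "p \<in> U"
  shows "\<rho> (act r p) * (K * Q (act r p)) * speed j p = differential (f\<epsilon> j) p (frame (Inl r))"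
  using assms Q_nonzero[of p] U_subset_M K_nonzero
  by (cases "j = r") (auto simp: speed_def differential_f\<epsilon>_r differential_f\<epsilon>_frame)

definition X\<epsilon> :: "'n \<Rightarrow> 'n phase \<Rightarrow> 'n phase" where
  "X\<epsilon> j p = ham_vec r (speed j p) (differential (f\<epsilon> j) p)"

lemma \<omega>\<epsilon>_X\<epsilon>: "p \<in> U \<Longrightarrow> \<omega>\<epsilon> p (X\<epsilon> j p) v = - differential (f\<epsilon> j) p v"
  unfolding \<omega>\<epsilon>_eq X\<epsilon>_def
  by (rule split_form_ham_vec) (auto simp: linear_df\<epsilon> speed_eq differential_f\<epsilon>_angle)

lemma smooth_speed: "smooth_on U (speed j)"
proof (cases "j = r")
  case True
  then show ?thesis
    by (simp add: speed_def[abs_def] smooth_on_const open_U)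
next
  case False
  have "smooth_on U (\<lambda>p. differential (f j) (\<Psi> p) (frame (Inl r)))"
    by (rule smooth_on_compose[OF smooth_on_differential[OF smooth_f[OF False]] smooth_\<Psi>[OF open_U] open_U])
      (use \<Psi>_in_M in auto)
  then have "smooth_on U (\<lambda>p. act r p ^ m / (K * Q (act r p)) * differential (f j) (\<Psi> p) (frame (Inl r)))"
    by (intro smooth_on_mult open_U smooth_on_subset[OF smooth_on_ratio U_subset_M])
  then show ?thesis
    using False by (simp add: speed_def[abs_def])
qed

lemma smooth_X\<epsilon>: "smooth_on U (X\<epsilon> j)"
proof (rule smooth_on_phaseI[OF open_U])
  fix a
  note d = smooth_on_differential[OF smooth_f\<epsilon>]
  show "smooth_on U (\<lambda>p. act a (X\<epsilon> j p))"
    by (cases "a = r") (simp_all add: X\<epsilon>_def smooth_on_const smooth_on_minus open_U d)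
  show "smooth_on U (\<lambda>p. ang a (X\<epsilon> j p))"
    by (cases "a = r") (simp_all add: X\<epsilon>_def smooth_speed d)
qed

lemma f\<epsilon>_shift:
  assumes "p \<in> U"
  shows "f\<epsilon> j (p + (2 * pi) *\<^sub>R frame (Inr a)) = f\<epsilon> j p"
proof (cases "j = r")
  case True
  then show ?thesis
    by (simp add: desing_map_def)
next
  case False
  then have "angle_periodic_on M (f j)"
    using f_smooth unfolding M_def by blast
  then show ?thesis
    using assms False \<Psi>_in_M[OF assms]
    by (simp add: f\<epsilon>_eq \<Psi>_shift angle_periodic_on_def angle_shift)
qed

lemma X\<epsilon>_shift:
  assumes "p \<in> U"
  shows "X\<epsilon> j (p + (2 * pi) *\<^sub>R frame (Inr a)) = X\<epsilon> j p"
proof -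
  have "differential (f\<epsilon> j) (p + (2 * pi) *\<^sub>R frame (Inr a)) = differential (f\<epsilon> j) p"
    by (rule differential_translate[OF open_U _ smooth_f\<epsilon> assms]) (simp add: f\<epsilon>_shift)
  moreover have "speed j (p + (2 * pi) *\<^sub>R frame (Inr a)) = speed j p"
  proof (cases "j = r")
    case False
    then have "angle_periodic_on M (f j)"
      using f_smooth unfolding M_def by blast
    then have "differential (f j) (\<Psi> p + (2 * pi) *\<^sub>R frame (Inr a)) = differential (f j) (\<Psi> p)"
      by (intro differential_translate[OF open_M _ smooth_f[OF False] \<Psi>_in_M[OF assms]])
        (simp add: angle_periodic_on_def angle_shift)
    then show ?thesis
      by (simp add: speed_def \<Psi>_shift)
  qed (simp add: speed_def)
  ultimately show ?thesis
    by (simp add: X\<epsilon>_def)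
qed

lemma hamiltonian_vf_X\<epsilon>: "hamiltonian_vf U \<omega>\<epsilon> (f\<epsilon> j) (X\<epsilon> j)"
  unfolding hamiltonian_vf_def vector_field_on_def angle_periodic_on_def angle_shift
  using smooth_X\<epsilon> X\<epsilon>_shift \<omega>\<epsilon>_X\<epsilon> by blast

text \<open>Where f_eps' vanishes the form is degenerate and the defining equation leaves the vector
  undetermined. Off Z the form is nondegenerate, and continuity of both fields settles the remaining
  points.\<close>

lemma hamiltonian_vf_unique:
  assumes "hamiltonian_vf U \<omega>\<epsilon> (f\<epsilon> j) X" and "p \<in> U"
  shows "X p = X\<epsilon> j p"
proof (rule eq_off_hypersurface[where r = r, OF open_U _ smooth_on_imp_continuous_on[OF smooth_X\<epsilon>] _ \<open>p \<in> U\<close>])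
  show "continuous_on U X"
    using assms by (simp add: hamiltonian_vf_def vector_field_on_def smooth_on_imp_continuous_on)
  fix p assume p: "p \<in> U - hypersurface r"
  define w where "w = \<rho> (act r p) * (K * Q (act r p))"
  have "w \<noteq> 0"
    using p \<rho>_nonzero[of "act r p"] Q_nonzero[of p] U_subset_M by (auto simp: w_def hypersurface_def)
  have w: "split_form r w = \<omega>\<epsilon> p"
    by (simp add: w_def \<omega>\<epsilon>_eq)
  have "split_form r w (X p - X\<epsilon> j p) v = 0" for v
    using assms(1) p \<omega>\<epsilon>_X\<epsilon>[of p j v]
    unfolding split_form_diff_left unfolding w
    by (simp add: hamiltonian_vf_def)
  from split_form_nondegenerate[OF \<open>w \<noteq> 0\<close> this] show "X p = X\<epsilon> j p"
    by simp
qed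

text \<open>The differential of the function with index \<open>r\<close> is a multiple of dI_r and
  drops out of the reduced bracket. For the other indices the bracket at \<open>p\<close> is that of
  the original functions at \<open>\<Psi> p\<close>.\<close>

lemma commuting_f\<epsilon>: "commuting_on U \<omega>\<epsilon> f\<epsilon>"
proof -
  have "\<omega>\<epsilon> p (X\<epsilon> i p) (X\<epsilon> j p) = 0" if "p \<in> U" for i j p
  proof -
    have "reduced_bracket r (differential (f\<epsilon> i) p) (differential (f\<epsilon> j) p) = 0"
    proof (cases "i = r \<or> j = r")
      case True
      then show ?thesis
        by (auto simp: reduced_bracket_def differential_f\<epsilon>_r split: if_splits intro!: sum.neutral)
    next
      case False
      then have "reduced_bracket r (differential (f\<epsilon> i) p) (differential (f\<epsilon> j) p) =
          reduced_bracket r (differential (f i) (\<Psi> p)) (differential (f j) (\<Psi> p))"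
        using that by (simp add: reduced_bracket_def differential_f\<epsilon>_frame)
      then show ?thesis
        using False reduced_bracket_f \<Psi>_in_M[OF that] by simp
    qed
    then show ?thesis
      by (simp add: \<omega>\<epsilon>_eq X\<epsilon>_def split_form_ham_vec_ham_vec)
  qed
  then show ?thesis
    unfolding commuting_on_def using hamiltonian_vf_X\<epsilon> by blast
qed

section \<open>Closedness of the form and independence of the functions\<close>

lemma smooth_weight: "smooth_on UNIV (\<lambda>x. \<rho> x * (K * Q x))"
  by (intro smooth_on_mult smooth_\<rho> smooth_on_const smooth_on_modular_poly open_UNIV)

lemma two_form_\<omega>\<epsilon>: "two_form_on U \<omega>\<epsilon>"
  unfolding two_form_on_def
proof (intro conjI ballI allI)
  show "smooth_on U (\<lambda>p. \<omega>\<epsilon> p u v)" for u v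
    unfolding \<omega>\<epsilon>_eq split_form_def
    by (intro smooth_on_add[OF open_U] smooth_on_mult[OF open_U] smooth_on_const[OF open_U]
        smooth_on_compose_act[OF smooth_weight open_U])
  show "angle_periodic_on U \<omega>\<epsilon>"
    by (simp add: angle_periodic_on_def angle_shift \<omega>\<epsilon>_eq)
qed (simp_all add: \<omega>\<epsilon>_eq split_form_linear_right split_form_linear_left)

text \<open>The weight depends on I_r alone, so in its exterior derivative dI_r occurs
  twice.\<close>

lemma closed_\<omega>\<epsilon>: "closed_form_on U \<omega>\<epsilon>"
proof -
  let ?w = "\<lambda>x. \<rho> x * (K * Q x)"
  have "differential (\<lambda>q. \<omega>\<epsilon> q u v) p = (\<lambda>z. deriv ?w (act r p) * act r z * wedge (act r) (ang r) u v)"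
    for p u v
  proof (rule differential_eqI)
    have "((\<lambda>q. ?w (act r q)) has_derivative (\<lambda>z. deriv ?w (act r p) * act r z)) (at p)"
      by (intro has_derivative_compose_act smooth_on_deriv[OF smooth_weight]) simp
    from has_derivative_add[OF has_derivative_mult_left[OF this] has_derivative_const]
    show "((\<lambda>q. \<omega>\<epsilon> q u v) has_derivative
        (\<lambda>z. deriv ?w (act r p) * act r z * wedge (act r) (ang r) u v)) (at p)"
      unfolding \<omega>\<epsilon>_eq split_form_def by simp
  qed
  then show ?thesis
    by (simp add: closed_form_on_def wedge_def algebra_simps)
qed

text \<open>On the directions other than I_r and \<phi>_r the function with index \<open>r\<close>
  contributes nothing and the others have the derivatives of \<open>f j\<close> at
  \<open>\<Psi> p\<close>, so any linear relation descends to one at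
  \<open>\<Psi> p\<close>.\<close>

lemma reduced_independent_f\<epsilon>:
  assumes "p \<in> U" and "reduced_independent (\<Psi> p)"
    and "\<And>v. (\<Sum>j\<in>UNIV. a j * differential (f\<epsilon> j) p v) = 0" and "j \<noteq> r"
  shows "a j = 0"
proof -
  have "(\<Sum>j\<in>UNIV - {r}. a j * differential (f j) (\<Psi> p) (frame (Inl b))) = 0 \<and>
      (\<Sum>j\<in>UNIV - {r}. a j * differential (f j) (\<Psi> p) (frame (Inr b))) = 0" if "b \<noteq> r" for b
    using assms(3)[of "frame (Inl b)"] assms(3)[of "frame (Inr b)"] that assms(1)
    unfolding sum_split_r by (simp add: differential_f\<epsilon>_r differential_f\<epsilon>_frame)
  then show ?thesis
    using assms(2,4) unfolding reduced_independent_def by blast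
qed

lemma independent_f\<epsilon>:
  assumes "p \<in> U" and "reduced_independent (\<Psi> p)" and "\<rho> (act r p) \<noteq> 0"
  shows "independent_covectors (\<lambda>j. differential (f\<epsilon> j) p)"
  unfolding independent_covectors_def
proof (intro allI impI)
  fix a j assume *: "\<forall>v. (\<Sum>j\<in>UNIV. a j * differential (f\<epsilon> j) p v) = 0"
  then have a: "a j = 0" if "j \<noteq> r" for j
    using reduced_independent_f\<epsilon>[OF assms(1,2) _ that] by blast
  have "a r * (\<rho> (act r p) * Q (act r p)) = 0"
    using *[rule_format, of "frame (Inl r)"] unfolding sum_split_r
    by (simp add: differential_f\<epsilon>_r a)
  then have "a r = 0"
    using assms(3) Q_nonzero[of p] U_subset_M assms(1) by auto
  then show "a j = 0"
    using a by (cases "j = r") auto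
qed

lemma reduced_independent_\<Psi>_hypersurface:
  assumes "p \<in> U \<inter> hypersurface r"
  shows "reduced_independent (\<Psi> p)"
proof -
  have "p \<in> M \<inter> hypersurface r"
    using assms U_subset_M by blast
  then have "reduced_independent p"
    using reduced_independent_dense by blast
  then show ?thesis
    using assms \<Psi>_on_hypersurface[of p] by simp
qed

text \<open>The derivative of \<open>\<Psi>\<close> is singular on Z, as h'(0) = 0, so openness
  comes from injectivity and continuity instead of the inverse function theorem.\<close>

lemma reduced_independent_\<Psi>_dense: "U \<subseteq> closure {p \<in> U. reduced_independent (\<Psi> p)}"
proof (rule ccontr)
  let ?D = "{p \<in> U. reduced_independent (\<Psi> p)}"
  assume "\<not> U \<subseteq> closure ?D"
  then have ne: "U - closure ?D \<noteq> {}"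
    by auto
  obtain D where D: "M \<subseteq> closure D" "\<forall>p\<in>D. reduced_independent p"
    using reduced_independent_dense by blast
  have "open (\<Psi> ` (U - closure ?D))"
    by (rule invariance_of_domain)
      (auto intro: open_Diff open_U smooth_on_imp_continuous_on smooth_\<Psi> inj_on_subset[OF inj_\<Psi>])
  moreover have "\<Psi> ` (U - closure ?D) \<subseteq> closure D"
    using \<Psi>_in_M D(1) by auto
  ultimately have "\<Psi> ` (U - closure ?D) \<inter> D \<noteq> {}"
    using ne open_Int_closure_eq_empty[of "\<Psi> ` (U - closure ?D)" D] by auto
  then obtain p where "p \<in> U - closure ?D" "\<Psi> p \<in> D"
    by blast
  then show False
    using D(2) closure_subset[of ?D] by blast
qed

lemma f\<epsilon>_smooth_periodic: "smooth_on U (f\<epsilon> j) \<and> angle_periodic_on U (f\<epsilon> j)"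
  using smooth_f\<epsilon> by (simp add: angle_periodic_on_def angle_shift f\<epsilon>_shift)

text \<open>For m even f_eps' has no zero, not even at 0, so the form is nondegenerate on Z too and
  reduced independence upgrades to independence of all n differentials.\<close>

theorem integrable_system_f\<epsilon>:
  assumes "even m"
  shows "integrable_system U \<omega>\<epsilon> f\<epsilon>"
proof -
  have "nondegenerate_on U \<omega>\<epsilon>"
    unfolding nondegenerate_on_def \<omega>\<epsilon>_eq
  proof (intro ballI allI impI)
    fix p u assume "p \<in> U" and u: "\<forall>v. split_form r (\<rho> (act r p) * (K * Q (act r p))) u v = 0"
    then have "\<rho> (act r p) * (K * Q (act r p)) \<noteq> 0"
      using \<rho>_even[OF assms] Q_nonzero[of p] U_subset_M by auto
    then show "u = 0"
      by (rule split_form_nondegenerate) (rule u[rule_format])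
  qed
  then have "symplectic_on U \<omega>\<epsilon>"
    by (simp add: symplectic_on_def two_form_\<omega>\<epsilon> closed_\<omega>\<epsilon>)
  moreover have "\<forall>p\<in>{p \<in> U. reduced_independent (\<Psi> p)}. independent_covectors (\<lambda>j. differential (f\<epsilon> j) p)"
    using independent_f\<epsilon> \<rho>_even[OF assms] by blast
  then have "\<exists>D\<subseteq>U. U \<subseteq> closure D \<and> (\<forall>p\<in>D. independent_covectors (\<lambda>j. differential (f\<epsilon> j) p))"
    using reduced_independent_\<Psi>_dense
    by (intro exI[of _ "{p \<in> U. reduced_independent (\<Psi> p)}"]) blast
  ultimately show ?thesis
    unfolding integrable_system_def using phase_domain_U commuting_f\<epsilon> f\<epsilon>_smooth_periodic by blast
qed

section \<open>Odd m: the fold along Z\<close>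

lemma weight_DERIV_odd:
  assumes "odd m"
  obtains d where "d \<noteq> 0" and "((\<lambda>x. \<rho> x * (K * Q x)) has_real_derivative d) (at 0)"
proof -
  obtain d where d: "d \<noteq> 0" "\<rho> 0 = 0" "(\<rho> has_real_derivative d) (at 0)"
    using \<rho>_odd[OF assms] by blast
  have "((\<lambda>x. K * Q x) has_real_derivative K * deriv Q 0) (at 0)"
    by (intro DERIV_cmult smooth_on_deriv[OF smooth_on_modular_poly]) simp
  \<comment> \<open>Since f_eps'(0) = 0, only the term f_eps''(0) K P(0) of the product rule
    survives, and P(0) \<noteq> 0 because \<open>M\<close> meets Z.\<close>
  from DERIV_mult[OF d(3) this]
  have "((\<lambda>x. \<rho> x * (K * Q x)) has_real_derivative d * (K * Q 0)) (at 0)"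
    using d(2) by simp
  moreover obtain p where "p \<in> M" "act r p = 0"
    using meets_hypersurface by (auto simp: M_def hypersurface_def)
  then have "K * Q 0 \<noteq> 0"
    using Q_nonzero[of p] by simp
  ultimately show ?thesis
    using that[of "d * (K * Q 0)"] d(1) by simp
qed

lemma \<rho>_0_odd: "odd m \<Longrightarrow> \<rho> 0 = 0"
  using \<rho>_odd by blast

text \<open>The top power is a nonzero constant times the weight, which has a simple zero at x = 0
  and no other zero on \<open>U\<close>. On Z the form reduces to the pairs a \<noteq> r, whose
  kernel inside the tangent space of Z is the line along \<phi>_r.\<close>

lemma folded_symplectic_\<omega>\<epsilon>:
  assumes "odd m"
  shows "folded_symplectic_on r U \<omega>\<epsilon>"
proof -
  obtain C where "C \<noteq> 0"
    and C: "\<forall>\<omega> w. \<forall>p :: 'n phase. \<omega> p = split_form r w \<longrightarrow> top_power \<omega> p = C * w"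
    using top_power_split_form[of r] by (elim exE conjE)
  have top: "top_power \<omega>\<epsilon> p = C * (\<rho> (act r p) * (K * Q (act r p)))" for p
    by (rule C[rule_format, OF \<omega>\<epsilon>_eq])
  have "{p \<in> U. top_power \<omega>\<epsilon> p = 0} = U \<inter> hypersurface r"
    using Q_nonzero U_subset_M \<rho>_nonzero \<rho>_0_odd[OF assms] \<open>C \<noteq> 0\<close>
    by (auto simp: top hypersurface_def)
  moreover have "differential (top_power \<omega>\<epsilon>) p \<noteq> (\<lambda>_. 0)" if "p \<in> U \<inter> hypersurface r" for p
  proof -
    obtain d where "d \<noteq> 0" and d: "((\<lambda>x. \<rho> x * (K * Q x)) has_real_derivative d) (at 0)"
      using weight_DERIV_odd[OF assms] by blast
    have "((\<lambda>x. C * (\<rho> x * (K * Q x))) has_real_derivative C * d) (at (act r p))"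
      using that DERIV_cmult[OF d, of C] by (simp add: hypersurface_def)
    from has_derivative_compose_act[OF this]
    have "differential (top_power \<omega>\<epsilon>) p = (\<lambda>v. C * d * act r v)"
      by (intro differential_eqI) (simp add: top[abs_def])
    then have "differential (top_power \<omega>\<epsilon>) p (frame (Inl r)) \<noteq> 0"
      using \<open>C \<noteq> 0\<close> \<open>d \<noteq> 0\<close> by simp
    then show ?thesis
      by auto
  qed
  moreover have "dim {u. act r u = 0 \<and> (\<forall>v. act r v = 0 \<longrightarrow> \<omega>\<epsilon> p u v = 0)} = 1"
    if "p \<in> U \<inter> hypersurface r" for p
  proof -
    have \<omega>\<epsilon>: "\<omega>\<epsilon> p = split_form r 0"
      using that \<rho>_0_odd[OF assms] by (simp add: \<omega>\<epsilon>_eq hypersurface_def)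
    have "{u. act r u = 0 \<and> (\<forall>v. act r v = 0 \<longrightarrow> \<omega>\<epsilon> p u v = 0)} = span {frame (Inr r)}"
    proof (intro equalityI subsetI)
      fix u assume "u \<in> {u. act r u = 0 \<and> (\<forall>v. act r v = 0 \<longrightarrow> \<omega>\<epsilon> p u v = 0)}"
      then have "act r u = 0" and u: "\<And>v. act r v = 0 \<Longrightarrow> split_form r 0 u v = 0"
        by (auto simp: \<omega>\<epsilon>)
      have "u = ang r u *\<^sub>R frame (Inr r)"
      proof (rule phase_eqI)
        fix a
        show "act a u = act a (ang r u *\<^sub>R frame (Inr r))"
          using u[of "frame (Inr a)"] \<open>act r u = 0\<close> by (cases "a = r") auto
        show "ang a u = ang a (ang r u *\<^sub>R frame (Inr r))"
          using u[of "frame (Inl a)"] by (cases "a = r") auto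
      qed
      then show "u \<in> span {frame (Inr r)}"
        by (subst \<open>u = _\<close>) (intro span_scale span_base, simp)
    next
      fix u :: "'n phase" assume "u \<in> span {frame (Inr r)}"
      then obtain t where "u = t *\<^sub>R frame (Inr r)"
        by (auto simp: span_singleton)
      then show "u \<in> {u. act r u = 0 \<and> (\<forall>v. act r v = 0 \<longrightarrow> \<omega>\<epsilon> p u v = 0)}"
        by (auto simp: \<omega>\<epsilon> split_form_def wedge_def laurent_beta_def)
    qed
    moreover have "frame (Inr r) \<noteq> (0 :: 'n phase)"
      by (simp add: frame_def axis_eq_0_iff prod_eq_iff)
    ultimately show ?thesis
      by (simp add: dim_eq_card_independent independent_insert)
  qed
  ultimately show ?thesis
    by (simp add: folded_symplectic_on_def two_form_\<omega>\<epsilon> closed_\<omega>\<epsilon>)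
qed

text \<open>The kernel on Z is spanned by the directions I_r and \<phi>_r. The differential kills
  the second by invariance, and the first because its value there is the weight times the finite
  \<open>speed\<close>.\<close>

lemma folded_function_f\<epsilon>:
  assumes "odd m"
  shows "folded_function_on r U \<omega>\<epsilon> (f\<epsilon> j)"
proof -
  have "differential (f\<epsilon> j) p v = 0" if p: "p \<in> U \<inter> hypersurface r" and v: "v \<in> fold_kernel \<omega>\<epsilon> p" for p v
  proof -
    have \<rho>: "\<rho> (act r p) = 0" and "p \<in> U"
      using p \<rho>_0_odd[OF assms] by (auto simp: hypersurface_def)
    have ker: "split_form r 0 v u = 0" for u
      using v \<rho> by (simp add: fold_kernel_def \<omega>\<epsilon>_eq)
    have "act a v = 0" "ang a v = 0" if "a \<noteq> r" for a
      using ker[of "frame (Inr a)"] ker[of "frame (Inl a)"] that by simp_all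
    moreover have "differential (f\<epsilon> j) p (frame (Inl r)) = 0"
      using speed_eq[OF \<open>p \<in> U\<close>, of j] \<rho> by simp
    ultimately show ?thesis
      using differential_f\<epsilon>_angle[OF \<open>p \<in> U\<close>]
      by (subst linear_phase_expansion[OF linear_df\<epsilon>[OF \<open>p \<in> U\<close>]], subst sum_split_r) simp
  qed
  then show ?thesis
    using f\<epsilon>_smooth_periodic by (simp add: folded_function_on_def)
qed

text \<open>On Z the differential of the function with index \<open>r\<close> is zero as a covector,
  but as a section it is f_eps' P dI_r. There x dI_r is a nonvanishing section of the folded
  cotangent bundle, and f_eps' P has only a simple zero.\<close>

lemma folded_independent_f\<epsilon>:
  assumes "odd m" and "p \<in> U" and "reduced_independent (\<Psi> p)"
  shows "folded_independent_at r U \<omega>\<epsilon> f\<epsilon> p"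
  unfolding folded_independent_at_def
proof (intro allI impI)
  fix a j
  assume "folded_vanishes_at r U \<omega>\<epsilon> (\<lambda>q v. \<Sum>j\<in>UNIV. a j * differential (f\<epsilon> j) q v) p"
  then obtain W N g \<alpha> where W: "open W" "p \<in> W" "W \<subseteq> U"
    and g: "\<And>k. k < N \<Longrightarrow> smooth_on W (g k) \<and> g k p = 0 \<and> folded_one_form_on r W \<omega>\<epsilon> (\<alpha> k)"
    and eq: "\<And>q v. q \<in> W \<Longrightarrow> (\<Sum>j\<in>UNIV. a j * differential (f\<epsilon> j) q v) = (\<Sum>k<(N::nat). g k q * \<alpha> k q v)"
    unfolding folded_vanishes_at_def by blast
  have zero: "(\<Sum>j\<in>UNIV. a j * differential (f\<epsilon> j) p v) = 0" for v
    using eq[OF \<open>p \<in> W\<close>] g by simp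
  have a: "a j = 0" if "j \<noteq> r" for j
    by (rule reduced_independent_f\<epsilon>[OF assms(2,3) zero that])
  have "a r = 0"
  proof (cases "p \<in> hypersurface r")
    case False
    then have "\<rho> (act r p) \<noteq> 0"
      by (intro \<rho>_nonzero) (simp add: hypersurface_def)
    then show ?thesis
      using independent_f\<epsilon>[OF assms(2,3)] zero unfolding independent_covectors_def by blast
  next
    case True
    let ?e = "frame (Inl r) :: 'n phase"
    obtain d where "d \<noteq> 0" and d: "((\<lambda>x. \<rho> x * (K * Q x)) has_real_derivative d) (at 0)"
      using weight_DERIV_odd[OF assms(1)] by blast
    have "act r p = 0"
      using True by (simp add: hypersurface_def)
    text \<open>Both sides of \<open>eq\<close> on \<open>\<partial>I\<^sub>r\<close>, which spans \<open>V\<close> modulo \<open>\<partial>\<phi>\<^sub>r\<close>, vanish at \<open>p\<close>; the right-hand side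
      vanishes to second order there.\<close>
    have "?e \<in> fold_kernel \<omega>\<epsilon> p"
      using \<open>act r p = 0\<close> \<rho>_0_odd[OF assms(1)]
      by (simp add: fold_kernel_def \<omega>\<epsilon>_eq split_form_def wedge_def laurent_beta_def)
    then have \<alpha>: "\<alpha> k p ?e = 0" if "k < N" for k
      using g[OF that] True \<open>p \<in> W\<close> by (simp add: folded_one_form_on_def)
    have "((\<lambda>q. g k q * \<alpha> k q ?e) has_derivative (\<lambda>_. 0)) (at p)" if "k < N" for k
    proof -
      have "smooth_on W (g k)" "smooth_on W (\<lambda>q. \<alpha> k q ?e)"
        using g[OF that] by (auto simp: folded_one_form_on_def)
      from has_derivative_mult[OF this[THEN smooth_on_has_derivative[OF _ \<open>p \<in> W\<close>]]]
      show ?thesis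
        using g[OF that] \<alpha>[OF that] by simp
    qed
    then have "((\<lambda>q. \<Sum>k<N. g k q * \<alpha> k q ?e) has_derivative (\<lambda>_. \<Sum>k<N. 0)) (at p)"
      by (intro has_derivative_sum) auto
    then have 1: "((\<lambda>q. a r * differential (f\<epsilon> r) q ?e) has_derivative (\<lambda>_. \<Sum>k<N. 0)) (at p)"
      by (rule has_derivative_transform_within_open[OF _ W(1,2)])
        (simp add: eq[symmetric] sum_split_r a)
    \<comment> \<open>Dividing by K turns the weight f_eps' K P, whose derivative at 0 is
      \<open>d\<close>, into the coefficient f_eps' P of dI_r.\<close>
    have "((\<lambda>x. a r / K * (\<rho> x * (K * Q x))) has_real_derivative a r / K * d) (at (act r p))"
      using DERIV_cmult[OF d, of "a r / K"] \<open>act r p = 0\<close> by simp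
    from has_derivative_compose_act[OF this]
    have 2: "((\<lambda>q. a r * differential (f\<epsilon> r) q ?e) has_derivative (\<lambda>v. a r / K * d * act r v)) (at p)"
      using K_nonzero by (simp add: differential_f\<epsilon>_r mult_ac)
    have "a r / K * d * act r ?e = (\<Sum>k<N. 0)"
      by (rule fun_cong[OF has_derivative_unique[OF 2 1]])
    then show ?thesis
      using \<open>d \<noteq> 0\<close> K_nonzero by simp
  qed
  then show "a j = 0"
    using a by (cases "j = r") auto
qed

theorem folded_integrable_system_f\<epsilon>:
  assumes "odd m"
  shows "folded_integrable_system r U \<omega>\<epsilon> f\<epsilon>"
proof -
  let ?D = "{p \<in> U. reduced_independent (\<Psi> p)}"
  have "U \<inter> hypersurface r \<subseteq> ?D \<inter> hypersurface r"
    using reduced_independent_\<Psi>_hypersurface by auto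
  also have "\<dots> \<subseteq> closure (?D \<inter> hypersurface r)"
    by (rule closure_subset)
  finally show ?thesis
    unfolding folded_integrable_system_def
    using phase_domain_U folded_symplectic_\<omega>\<epsilon>[OF assms] folded_function_f\<epsilon>[OF assms] commuting_f\<epsilon>
      reduced_independent_\<Psi>_dense folded_independent_f\<epsilon>[OF assms]
    by (intro conjI exI[of _ ?D]) simp_all
qed

section \<open>Comparison of the two families of vector fields\<close>

lemma X\<epsilon>_r: "X\<epsilon> r p = (1 / K) *\<^sub>R frame (Inr r)"
  by (rule phase_eqI) (auto simp: X\<epsilon>_def speed_def differential_f\<epsilon>_r)

lemma X\<epsilon>_eq:
  assumes "j \<noteq> r" and "p \<in> U"
  shows "X\<epsilon> j p = ham_vec r (act r p ^ m / (K * Q (act r p)) * differential (f j) (\<Psi> p) (frame (Inl r)))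
    (differential (f j) (\<Psi> p))"
  unfolding X\<epsilon>_def using assms
  by (simp add: speed_def) (rule ham_vec_cong, auto simp: differential_f\<epsilon>_frame)

text \<open>For j \<noteq> r both vectors are the same expression in a covector, with factor x^m /
  (K P(x)), taken at df_j(p) and at df_j(\<Psi>(p)). Off Z the factor is nonzero and the vector
  determines every component of the covector except that along \<phi>_r, which is zero for both. On
  Z the component along I_r is lost, but there \<Psi>(p) = p.\<close>

lemma vf_eq_iff:
  assumes "bm_hamiltonian_vf r m M \<omega> (f j) X" and "p \<in> U"
  shows "X p = X\<epsilon> j p \<longleftrightarrow> j = r \<or> differential (f j) (\<Psi> p) = differential (f j) p"
proof (cases "j = r")
  case True
  then show ?thesis
    using assms bm_vf_r_eq[of X p] U_subset_M by (auto simp: X\<epsilon>_r)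
next
  case False
  have "p \<in> M"
    using assms(2) U_subset_M by auto
  let ?s = "act r p ^ m / (K * Q (act r p))"
  let ?H = "\<lambda>L. ham_vec r (?s * L (frame (Inl r))) L"
  have "differential (f j) (\<Psi> p) = differential (f j) p"
    if eq: "?H (differential (f j) p) = ?H (differential (f j) (\<Psi> p))"
  proof (cases "p \<in> hypersurface r")
    case True
    then show ?thesis
      by (simp add: \<Psi>_on_hypersurface)
  next
    case p: False
    \<comment> \<open>A nonzero factor allows the component along I_r to be recovered from the
      angular velocity in direction \<phi>_r.\<close>
    then have s: "?s \<noteq> 0"
      using Q_nonzero[OF \<open>p \<in> M\<close>] by (simp add: hypersurface_def)
    show ?thesis
    proof (rule linear_phase_eqI)
      fix a
      show "differential (f j) (\<Psi> p) (frame (Inl a)) = differential (f j) p (frame (Inl a))"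
        using arg_cong[OF eq, of "ang a"] s unfolding ang_ham_vec
        by (cases "a = r") (simp_all only: if_True if_False simp_thms mult_cancel_left)
      show "differential (f j) (\<Psi> p) (frame (Inr a)) = differential (f j) p (frame (Inr a))"
        using arg_cong[OF eq, of "act a"] differential_f_angle[OF False] \<open>p \<in> M\<close> \<Psi>_in_M[OF assms(2)]
        by (cases "a = r") auto
    qed (auto intro: linear_differential[OF smooth_f[OF False]] \<open>p \<in> M\<close> \<Psi>_in_M[OF assms(2)])
  qed
  then show ?thesis
    unfolding bm_vf_eq[OF False assms(1) \<open>p \<in> M\<close>] X\<epsilon>_eq[OF False assms(2)] using False by auto
qed

text \<open>Measured with the original form, the desingularized field belongs to the covector df_j
  taken at \<Psi>(p), as opposed to the differential of f_j composed with \<Psi>: the factor h' has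
  been cancelled by the change of weight.\<close>

lemma \<omega>_X\<epsilon>:
  assumes "j \<noteq> r" and "p \<in> U - hypersurface r"
  shows "\<omega> p (X\<epsilon> j p) v = - differential (f j) (\<Psi> p) v"
proof -
  have x: "act r p \<noteq> 0" and "p \<in> U"
    using assms(2) by (auto simp: hypersurface_def)
  note \<Psi>p = \<Psi>_in_M[OF \<open>p \<in> U\<close>]
  show ?thesis
    unfolding action_angle_form_eq_split_form[OF x] X\<epsilon>_eq[OF assms(1) \<open>p \<in> U\<close>]
    using x Q_nonzero[of p] \<open>p \<in> U\<close> U_subset_M
    by (intro split_form_ham_vec linear_differential[OF smooth_f[OF assms(1)] \<Psi>p]
        differential_f_angle[OF assms(1) \<Psi>p]) auto
qed

end

theorem theoremC:
  fixes A :: "(real ^ 'n::finite) set" and M U :: "'n phase set"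
    and r :: 'n and m :: nat and c :: "nat \<Rightarrow> real" and K \<epsilon> :: real
    and F :: "real \<Rightarrow> real" and f f\<^sub>\<epsilon> :: "'n \<Rightarrow> 'n phase \<Rightarrow> real"
    and \<omega> \<omega>\<^sub>\<epsilon> :: "'n two_form" and \<Psi>\<^sub>\<epsilon> :: "'n phase \<Rightarrow> 'n phase"
  defines "M \<equiv> A \<times> UNIV"
    and "\<omega> \<equiv> action_angle_form r m K c"
    and "\<omega>\<^sub>\<epsilon> \<equiv> desing_form r m K c F \<epsilon>"
    and "f\<^sub>\<epsilon> \<equiv> desing_map r m K c F \<epsilon> f"
    and "\<Psi>\<^sub>\<epsilon> \<equiv> desing_coord r m K c F \<epsilon>"
    and "U \<equiv> desing_domain r m K c F \<epsilon> M"
  assumes "open A" and "convex A" and "M \<inter> hypersurface r \<noteq> {}"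
    and "m \<ge> 1" and "\<epsilon> > 0" and "desing_profile m F"
    and "bm_integrable_system r m M \<omega> f"
    and "\<And>p. p \<in> M - hypersurface r \<Longrightarrow>
           f r p = c 0 * ln \<bar>act r p\<bar> + (\<Sum>i=1..m-1. c i * (1 / act r p ^ i))"
    and "\<And>j. j \<noteq> r \<Longrightarrow> smooth_on M (f j) \<and> angle_periodic_on M (f j)"
  shows "M \<inter> hypersurface r \<subseteq> U \<and>
    (even m \<longrightarrow> integrable_system U \<omega>\<^sub>\<epsilon> f\<^sub>\<epsilon>) \<and>
    (odd m \<longrightarrow> folded_integrable_system r U \<omega>\<^sub>\<epsilon> f\<^sub>\<epsilon>) \<and>
    (\<forall>j X X\<^sub>\<epsilon>. bm_hamiltonian_vf r m M \<omega> (f j) X \<and> hamiltonian_vf U \<omega>\<^sub>\<epsilon> (f\<^sub>\<epsilon> j) X\<^sub>\<epsilon> \<longrightarrow>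
       (\<forall>p\<in>U. X p = X\<^sub>\<epsilon> p \<longleftrightarrow> j = r \<or> differential (f j) (\<Psi>\<^sub>\<epsilon> p) = differential (f j) p) \<and>
       (j \<noteq> r \<longrightarrow> (\<forall>p\<in>U - hypersurface r. \<forall>v. \<omega> p (X\<^sub>\<epsilon> p) v = - differential (f j) (\<Psi>\<^sub>\<epsilon> p) v)))"
proof -
  interpret desingularization A r m K c f F \<epsilon>
    using assms(7-15) unfolding assms(1,2) by unfold_locales auto
  note M_eq = assms(1)[folded local.M_def]
  have U_eq: "U = local.U"
    by (simp add: assms(6) local.U_def M_eq)
  have "X p = X\<^sub>\<epsilon> p \<longleftrightarrow> j = r \<or> differential (f j) (\<Psi>\<^sub>\<epsilon> p) = differential (f j) p"
    if "bm_hamiltonian_vf r m M \<omega> (f j) X" and "hamiltonian_vf U \<omega>\<^sub>\<epsilon> (f\<^sub>\<epsilon> j) X\<^sub>\<epsilon>" and "p \<in> U" for j X X\<^sub>\<epsilon> p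
    using that vf_eq_iff[of j X p] hamiltonian_vf_unique[of j X\<^sub>\<epsilon> p] differential_f_desing_coord[of j p]
    unfolding M_eq U_eq assms(2-5) by auto
  moreover have "\<omega> p (X\<^sub>\<epsilon> p) v = - differential (f j) (\<Psi>\<^sub>\<epsilon> p) v"
    if "hamiltonian_vf U \<omega>\<^sub>\<epsilon> (f\<^sub>\<epsilon> j) X\<^sub>\<epsilon>" and "j \<noteq> r" and "p \<in> U - hypersurface r" for j X\<^sub>\<epsilon> p v
    using that \<omega>_X\<epsilon>[of j p v] hamiltonian_vf_unique[of j X\<^sub>\<epsilon> p] differential_f_desing_coord[of j p]
    unfolding U_eq assms(2-5) by auto
  ultimately show ?thesis
    using hypersurface_in_U integrable_system_f\<epsilon> folded_integrable_system_f\<epsilon>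
    unfolding M_eq U_eq assms(3,4) by blast
qed

end
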